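(* Let $1<p<\infty$. Then the separable part of weak-$\ell_p$, i.e. the closure of $c_{00}$ in $\ell_{p,\infty}$, has a unique greedy basis.
   Context: Weak-$\ell_p$, denoted $\ell_{p,\infty}$, is the space of real sequences $(a_n)\in c_0$ with $\|(a_n)\|_{p,\infty}=\sup_n a_n^*\,n^{1/p}<\infty$, where $(a_n^* )$ is the decreasing rearrangement of $(|a_n|)$; for $1<p<\infty$ this quasi-norm is equivalent to a norm making $\ell_{p,\infty}$ a Banach space. $c_{00}$ is the space of finitely supported real sequences. Bases: a basis is a Schauder basis $(x_n)_{n=1}^\infty$, and all bases are assumed semi-normalized, i.e. $0<\inf_n\|x_n\|\le\sup_n\|x_n\|<\infty$. A basis $(x_n)$ of $X$ with biorthogonal functionals $(x_n^* )$ is greedy if there is a constant $C$ such that for every $x\in X$, every $N\in\mathbb{N}$, and every set $\Lambda\subseteq\mathbb{N}$ with $|\Lambda|=N$ and $\min_{n\in\Lambda}|x_n^*(x)|\ge\max_{n\notin\Lambda}|x_n^*(x)|$, one has $\|x-\sum_{n\in\Lambda}x_n^*(x)x_n\|\le C\inf\{\|x-\sum_{n\in A}\alpha_n x_n\| : |A|=N,\ \alpha_n\in\mathbb{R}\}$. Two bases $(x_n)$, $(y_n)$ are equivalent if there is $C\ge1$ with $C^{-1}\|\sum a_nx_n\|\le\|\sum a_ny_n\|\le C\|\sum a_nx_n\|$ for all finitely supported real sequences $(a_n)$. A Banach space has a unique greedy basis if it has a semi-normalized greedy basis $(e_n)$ and every semi-normalized greedy basis of the space is equivalent to $(e_n)$.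 *)

theory Defs
  imports "HOL-Analysis.Analysis" "HOL-Library.Function_Algebras"
begin

text \<open>The pointwise real vector space structure on functions; addition, zero and subtraction
  are those of \<^theory>\<open>HOL-Library.Function_Algebras\<close>.\<close>

instantiation "fun" :: (type, real_vector) real_vector
begin

definition scaleR_fun :: "real \<Rightarrow> ('a \<Rightarrow> 'b) \<Rightarrow> 'a \<Rightarrow> 'b"
  where "scaleR_fun c f = (\<lambda>x. c *\<^sub>R f x)"

instance
  by standard (auto simp: scaleR_fun_def fun_eq_iff scaleR_add_right scaleR_add_left)

end

section \<open>Bases of Banach spaces\<close>

text \<open>A normed space is a pair of a linear subspace \<open>X\<close> of an ambient real vector space and a
  function \<open>N\<close> whose values matter only on \<open>X\<close>. The ambient space carries no norm of its own.\<close>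

definition norm_on :: "'v::real_vector set \<Rightarrow> ('v \<Rightarrow> real) \<Rightarrow> bool" where
  "norm_on X N \<longleftrightarrow> subspace X \<and>
     (\<forall>x\<in>X. 0 \<le> N x \<and> (N x = 0 \<longleftrightarrow> x = 0)) \<and>
     (\<forall>x\<in>X. \<forall>c. N (c *\<^sub>R x) = \<bar>c\<bar> * N x) \<and>
     (\<forall>x\<in>X. \<forall>y\<in>X. N (x + y) \<le> N x + N y)"

definition banach_space_on :: "'v::real_vector set \<Rightarrow> ('v \<Rightarrow> real) \<Rightarrow> bool" where
  "banach_space_on X N \<longleftrightarrow> norm_on X N \<and>
     (\<forall>\<sigma>. range \<sigma> \<subseteq> X \<and> (\<forall>\<epsilon>>0. \<exists>n0. \<forall>m\<ge>n0. \<forall>n\<ge>n0. N (\<sigma> m - \<sigma> n) < \<epsilon>)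
        \<longrightarrow> (\<exists>l\<in>X. (\<lambda>n. N (\<sigma> n - l)) \<longlonglongrightarrow> 0))"

definition schauder_basis :: "'v::real_vector set \<Rightarrow> ('v \<Rightarrow> real) \<Rightarrow> (nat \<Rightarrow> 'v) \<Rightarrow> bool" where
  "schauder_basis X N x \<longleftrightarrow> range x \<subseteq> X \<and>
     (\<forall>v\<in>X. \<exists>!a::nat \<Rightarrow> real. (\<lambda>n. N (v - (\<Sum>k<n. a k *\<^sub>R x k))) \<longlonglongrightarrow> 0)"

text \<open>For a Schauder basis \<open>x\<close>, \<open>basis_coeff N x v n\<close> is the value at \<open>v\<close> of the \<open>n\<close>-th
  biorthogonal functional.\<close>

definition basis_coeff :: "('v::real_vector \<Rightarrow> real) \<Rightarrow> (nat \<Rightarrow> 'v) \<Rightarrow> 'v \<Rightarrow> nat \<Rightarrow> real" where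
  "basis_coeff N x v = (THE a. (\<lambda>n. N (v - (\<Sum>k<n. a k *\<^sub>R x k))) \<longlonglongrightarrow> 0)"

definition semi_normalized :: "('v \<Rightarrow> real) \<Rightarrow> (nat \<Rightarrow> 'v) \<Rightarrow> bool" where
  "semi_normalized N x \<longleftrightarrow> 0 < (INF n. N (x n)) \<and> bdd_above (range (\<lambda>n. N (x n)))"

text \<open>\<open>\<Lambda>\<close> is nonempty, so that \<open>card A = card \<Lambda>\<close> forces \<open>A\<close> to be finite.\<close>

definition greedy_basis :: "'v::real_vector set \<Rightarrow> ('v \<Rightarrow> real) \<Rightarrow> (nat \<Rightarrow> 'v) \<Rightarrow> bool" where
  "greedy_basis X N x \<longleftrightarrow> schauder_basis X N x \<and> semi_normalized N x \<and>
     (\<exists>C. \<forall>v\<in>X. \<forall>\<Lambda>. finite \<Lambda> \<and> \<Lambda> \<noteq> {} \<and>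
        (\<forall>n\<in>\<Lambda>. \<forall>m. m \<notin> \<Lambda> \<longrightarrow> \<bar>basis_coeff N x v m\<bar> \<le> \<bar>basis_coeff N x v n\<bar>)
        \<longrightarrow> N (v - (\<Sum>n\<in>\<Lambda>. basis_coeff N x v n *\<^sub>R x n))
            \<le> C * Inf {N (v - (\<Sum>n\<in>A. \<alpha> n *\<^sub>R x n)) | A \<alpha>. card A = card \<Lambda>})"

definition equivalent_bases ::
  "('v::real_vector \<Rightarrow> real) \<Rightarrow> (nat \<Rightarrow> 'v) \<Rightarrow> (nat \<Rightarrow> 'v) \<Rightarrow> bool" where
  "equivalent_bases N x y \<longleftrightarrow> (\<exists>C\<ge>1. \<forall>a::nat \<Rightarrow> real. finite {n. a n \<noteq> 0} \<longrightarrow>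
     (let sx = (\<Sum>n | a n \<noteq> 0. a n *\<^sub>R x n); sy = (\<Sum>n | a n \<noteq> 0. a n *\<^sub>R y n)
      in inverse C * N sx \<le> N sy \<and> N sy \<le> C * N sx))"

definition has_unique_greedy_basis :: "'v::real_vector set \<Rightarrow> ('v \<Rightarrow> real) \<Rightarrow> bool" where
  "has_unique_greedy_basis X N \<longleftrightarrow>
     (\<exists>e. greedy_basis X N e \<and> (\<forall>x. greedy_basis X N x \<longrightarrow> equivalent_bases N x e))"

section \<open>Weak \<open>\<ell>\<^sub>p\<close>\<close>

text \<open>Sequences are indexed from \<open>0\<close>: \<open>decreasing_rearrangement a n\<close> is the \<open>(n+1)\<close>-st largest
  value of \<open>\<bar>a\<bar>\<close>. The finiteness condition is needed because \<open>card\<close> of an infinite set is \<open>0\<close>.\<close>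

definition decreasing_rearrangement :: "(nat \<Rightarrow> real) \<Rightarrow> nat \<Rightarrow> real" where
  "decreasing_rearrangement a n =
     Inf {t. 0 \<le> t \<and> finite {k. t < \<bar>a k\<bar>} \<and> card {k. t < \<bar>a k\<bar>} \<le> n}"

definition weak_lp_qnorm :: "real \<Rightarrow> (nat \<Rightarrow> real) \<Rightarrow> real" where
  "weak_lp_qnorm p a = (SUP n. decreasing_rearrangement a n * real (n + 1) powr (1 / p))"

definition weak_lp :: "real \<Rightarrow> (nat \<Rightarrow> real) set" where
  "weak_lp p = {a. a \<longlonglongrightarrow> 0 \<and>
     bdd_above (range (\<lambda>n. decreasing_rearrangement a n * real (n + 1) powr (1 / p)))}"

definition c00 :: "(nat \<Rightarrow> real) set" where
  "c00 = {a. finite {k. a k \<noteq> 0}}"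

definition weak_lp_separable_part :: "real \<Rightarrow> (nat \<Rightarrow> real) set" where
  "weak_lp_separable_part p =
     {a \<in> weak_lp p. \<forall>\<epsilon>>0. \<exists>b\<in>c00. weak_lp_qnorm p (a - b) < \<epsilon>}"

definition weak_lp_equivalent_norm :: "real \<Rightarrow> ((nat \<Rightarrow> real) \<Rightarrow> real) \<Rightarrow> bool" where
  "weak_lp_equivalent_norm p N \<longleftrightarrow> banach_space_on (weak_lp p) N \<and>
     (\<exists>C\<ge>1. \<forall>a\<in>weak_lp p.
        inverse C * weak_lp_qnorm p a \<le> N a \<and> N a \<le> C * weak_lp_qnorm p a)"

section \<open>Existence of an equivalent Banach norm\<close>

text \<open>For \<open>1 < p\<close> the norm \<open>sup\<^sub>A card A powr (1 / p - 1) * (\<Sum>k\<in>A. \<bar>a k\<bar>)\<close>, over finite nonempty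
  \<open>A\<close>, witnesses \<open>weak_lp_equivalent_norm p\<close>, so that predicate is satisfiable.\<close>

definition avg_weight :: "real \<Rightarrow> (nat \<Rightarrow> real) \<Rightarrow> nat set \<Rightarrow> real" where
  "avg_weight p a A = real (card A) powr (1 / p - 1) * (\<Sum>k\<in>A. \<bar>a k\<bar>)"

lemma rearr_bound:
  assumes "finite A" "card A = Suc n" "\<And>k. k \<in> A \<Longrightarrow> r \<le> \<bar>a k\<bar>" "a \<longlonglongrightarrow> 0"
  shows "r \<le> decreasing_rearrangement a n"
proof -
  let ?S = "{t. 0 \<le> t \<and> finite {k. t < \<bar>a k\<bar>} \<and> card {k. t < \<bar>a k\<bar>} \<le> n}"
  have "Bseq a" using assms(4) convergentI convergent_imp_Bseq by blast
  then obtain K where K: "K > 0" "\<And>k. \<bar>a k\<bar> \<le> K" by (auto simp: Bseq_def)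
  then have "{k. K < \<bar>a k\<bar>} = {}" by (auto simp: not_less)
  then have "K \<in> ?S" using K by simp
  moreover have "r \<le> t" if "t \<in> ?S" for t
  proof (rule ccontr)
    assume "\<not> r \<le> t"
    then have "A \<subseteq> {k. t < \<bar>a k\<bar>}" using assms(3) by force
    then have "card A \<le> card {k. t < \<bar>a k\<bar>}" using that by (intro card_mono) auto
    then show False using that assms(2) by simp
  qed
  ultimately show ?thesis unfolding decreasing_rearrangement_def
    by (intro cInf_greatest) auto
qed

lemma finite_level:
  fixes a :: "nat \<Rightarrow> real"
  assumes "a \<longlonglongrightarrow> 0" "t > 0"
  shows "finite {k. t < \<bar>a k\<bar>}"
proof -
  obtain n0 where "\<And>k. k \<ge> n0 \<Longrightarrow> \<bar>a k\<bar> < t" using LIMSEQ_D[OF assms] by auto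
  then have "{k. t < \<bar>a k\<bar>} \<subseteq> {..<n0}" by (force simp: not_le[symmetric])
  then show ?thesis using finite_subset by blast
qed

lemma rearr_attained:
  assumes "0 < r" "r < decreasing_rearrangement a n" "a \<longlonglongrightarrow> 0"
  obtains A where "finite A" "card A = Suc n" "\<And>k. k \<in> A \<Longrightarrow> r \<le> \<bar>a k\<bar>"
proof -
  let ?S = "{t. 0 \<le> t \<and> finite {k. t < \<bar>a k\<bar>} \<and> card {k. t < \<bar>a k\<bar>} \<le> n}"
  have "bdd_below ?S" by (rule bdd_belowI[of _ 0]) auto
  then have "r \<notin> ?S" using assms(2) cInf_lower[of r ?S] unfolding decreasing_rearrangement_def
    by linarith
  then have "Suc n \<le> card {k. r < \<bar>a k\<bar>}" using finite_level[OF assms(3,1)] assms(1) by auto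
  then obtain A where "A \<subseteq> {k. r < \<bar>a k\<bar>}" "card A = Suc n" "finite A"
    using obtain_subset_with_card_n by metis
  then show ?thesis using that[of A] by (auto intro: less_imp_le)
qed

lemma avg_weight_lower:
  assumes "a \<longlonglongrightarrow> 0" "\<And>A. finite A \<Longrightarrow> A \<noteq> {} \<Longrightarrow> avg_weight p a A \<le> m"
  shows "decreasing_rearrangement a n * real (n + 1) powr (1 / p) \<le> m"
proof (rule ccontr)
  let ?c = "real (n + 1) powr (1 / p)"
  have c: "?c > 0" by simp
  assume "\<not> ?thesis"
  then have *: "m / ?c < decreasing_rearrangement a n" using c by (simp add: field_simps)
  have "0 \<le> m" using assms(2)[of "{0}"] by (simp add: avg_weight_def)
  then have "0 \<le> m / ?c" using c by simp
  obtain r where r: "m / ?c < r" "r < decreasing_rearrangement a n" using dense[OF *] by blast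
  then have "r > 0" using \<open>0 \<le> m / ?c\<close> by linarith
  then obtain A where A: "finite A" "card A = Suc n" "\<And>k. k \<in> A \<Longrightarrow> r \<le> \<bar>a k\<bar>"
    using rearr_attained r assms(1) by blast
  have "real (n + 1) * r \<le> (\<Sum>k\<in>A. \<bar>a k\<bar>)"
    using sum_bounded_below[of A r "\<lambda>k. \<bar>a k\<bar>"] A by (simp add: add.commute)
  then have "real (n + 1) powr (1 / p - 1) * (real (n + 1) * r) \<le> avg_weight p a A"
    unfolding avg_weight_def A(2) Suc_eq_plus1 by (rule mult_left_mono) simp
  moreover have "real (n + 1) powr (1 / p - 1) * (real (n + 1) * r) = ?c * r"
    by (simp add: powr_diff)
  moreover have "avg_weight p a A \<le> m" using A by (intro assms(2)) auto
  ultimately have "?c * r \<le> m" by linarith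
  then show False using r(1) c by (simp add: field_simps)
qed

lemma sum_le_sum_rearr:
  assumes "a \<longlonglongrightarrow> 0" "finite A"
  shows "(\<Sum>k\<in>A. \<bar>a k\<bar>) \<le> (\<Sum>i<card A. decreasing_rearrangement a i)"
  using assms(2)
proof (induction "card A" arbitrary: A)
  case 0 then show ?case by simp
next
  case (Suc n)
  have "A \<noteq> {}" using Suc.hyps(2) by auto
  obtain k where k: "k \<in> A" "\<And>j. j \<in> A \<Longrightarrow> \<bar>a k\<bar> \<le> \<bar>a j\<bar>"
    using ex_is_arg_min_if_finite[OF Suc.prems \<open>A \<noteq> {}\<close>, of "\<lambda>k. \<bar>a k\<bar>"]
    by (auto simp: is_arg_min_linorder)
  have "\<bar>a k\<bar> \<le> decreasing_rearrangement a n"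
    using rearr_bound[of A n "\<bar>a k\<bar>" a] Suc k assms(1) by auto
  moreover have "(\<Sum>j\<in>A - {k}. \<bar>a j\<bar>) \<le> (\<Sum>i<n. decreasing_rearrangement a i)"
  proof -
    have n: "n = card (A - {k})" using Suc.hyps(2) Suc.prems k(1) by simp
    show ?thesis using Suc.hyps(1)[OF n] Suc.prems n by simp
  qed
  ultimately show ?case
    using sum.remove[of A k "\<lambda>j. \<bar>a j\<bar>"] Suc.prems k(1) by (simp add: Suc.hyps(2)[symmetric])
qed

lemma powr_step:
  fixes s :: real
  assumes "0 < s" "s < 1"
  shows "s * real (Suc n) powr (s - 1) \<le> real (Suc n) powr s - real n powr s"
proof (cases "n = 0")
  case True then show ?thesis using assms by simp
next
  case False
  then have "\<exists>z. real n < z \<and> z < real (Suc n) \<and>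
      real (Suc n) powr s - real n powr s = (real (Suc n) - real n) * (s * z powr (s - 1))"
    by (intro MVT2 has_real_derivative_powr) auto
  then obtain z where z: "real n < z" "z < real (Suc n)"
      "real (Suc n) powr s - real n powr s = s * z powr (s - 1)"
    by auto
  have "real (Suc n) powr (s - 1) \<le> z powr (s - 1)"
    using z assms by (intro powr_mono2') auto
  then show ?thesis using z(3) assms by simp
qed

lemma sum_powr_bound:
  fixes s :: real
  assumes "0 < s" "s < 1"
  shows "s * (\<Sum>i<n. real (Suc i) powr (s - 1)) \<le> real n powr s"
proof (induction n)
  case 0 then show ?case by simp
next
  case (Suc n)
  then show ?case using powr_step[OF assms, of n] by (simp add: distrib_left)
qed

lemma avg_weight_upper:
  assumes p: "1 < p" and a: "a \<longlonglongrightarrow> 0"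
    and q: "\<And>n. decreasing_rearrangement a n * real (n + 1) powr (1 / p) \<le> q"
    and A: "finite A" "A \<noteq> {}"
  shows "avg_weight p a A \<le> q / (1 - 1 / p)"
proof -
  define s where "s = 1 - 1 / p"
  have s: "0 < s" "s < 1" using p by (auto simp: s_def)
  have c: "real (card A) > 0" using A by (simp add: card_gt_0_iff)
  have D: "decreasing_rearrangement a i \<le> q * real (Suc i) powr (s - 1)" for i
  proof -
    have "real (i + 1) powr (1 / p) * real (Suc i) powr (s - 1) = 1"
      unfolding s_def powr_add[symmetric] Suc_eq_plus1 by simp
    then have "decreasing_rearrangement a i =
        decreasing_rearrangement a i * real (i + 1) powr (1 / p) * real (Suc i) powr (s - 1)"
      by (simp only: mult.assoc mult_1_right)
    also have "\<dots> \<le> q * real (Suc i) powr (s - 1)"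
      by (rule mult_right_mono[OF q]) simp
    finally show ?thesis .
  qed
  have "0 \<le> q"
  proof -
    have "0 \<le> decreasing_rearrangement a 0" using a by (intro rearr_bound[of "{0}"]) auto
    then show ?thesis using q[of 0] by simp
  qed
  have "(\<Sum>k\<in>A. \<bar>a k\<bar>) \<le> (\<Sum>i<card A. q * real (Suc i) powr (s - 1))"
    using sum_le_sum_rearr[OF a A(1)] D by (meson order_trans sum_mono)
  also have "\<dots> = (q / s) * (s * (\<Sum>i<card A. real (Suc i) powr (s - 1)))"
    using s by (simp add: sum_distrib_left)
  also have "\<dots> \<le> (q / s) * real (card A) powr s"
    using sum_powr_bound[OF s] \<open>0 \<le> q\<close> s by (intro mult_left_mono) auto
  finally have "real (card A) powr (- s) * (\<Sum>k\<in>A. \<bar>a k\<bar>)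
      \<le> real (card A) powr (- s) * ((q / s) * real (card A) powr s)"
    by (rule mult_left_mono) simp
  then have "avg_weight p a A \<le> real (card A) powr (- s) * ((q / s) * real (card A) powr s)"
    by (simp add: avg_weight_def s_def)
  also have "\<dots> = (q / s) * (real (card A) powr (- s) * real (card A) powr s)"
    by (simp only: mult_ac)
  also have "real (card A) powr (- s) * real (card A) powr s = 1"
    unfolding powr_add[symmetric] using c by simp
  finally show ?thesis unfolding s_def mult_1_right .
qed

abbreviation fin_sets :: "nat set set" where "fin_sets \<equiv> {A. finite A \<and> A \<noteq> {}}"

lemma weak_lp_iff:
  assumes "1 < p"
  shows "a \<in> weak_lp p \<longleftrightarrow> a \<longlonglongrightarrow> 0 \<and> bdd_above (avg_weight p a ` fin_sets)"
proof (intro iffI conjI)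
  assume "a \<in> weak_lp p"
  then show "a \<longlonglongrightarrow> 0" by (simp add: weak_lp_def)
  from \<open>a \<in> weak_lp p\<close> obtain q
    where "\<And>n. decreasing_rearrangement a n * real (n + 1) powr (1 / p) \<le> q"
    unfolding weak_lp_def bdd_above_def by auto
  then show "bdd_above (avg_weight p a ` fin_sets)"
    using avg_weight_upper[OF assms \<open>a \<longlonglongrightarrow> 0\<close>] by (intro bdd_aboveI2) auto
next
  assume *: "a \<longlonglongrightarrow> 0 \<and> bdd_above (avg_weight p a ` fin_sets)"
  then obtain m where "\<And>A. finite A \<Longrightarrow> A \<noteq> {} \<Longrightarrow> avg_weight p a A \<le> m"
    unfolding bdd_above_def by auto
  then show "a \<in> weak_lp p"
    using avg_weight_lower[of a p m] * unfolding weak_lp_def by (auto intro!: bdd_aboveI2)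
qed

definition weak_lp_norm :: "real \<Rightarrow> (nat \<Rightarrow> real) \<Rightarrow> real" where
  "weak_lp_norm p a = (SUP A\<in>fin_sets. avg_weight p a A)"

lemma avg_weight_add: "avg_weight p (a + b) A \<le> avg_weight p a A + avg_weight p b A"
  unfolding avg_weight_def distrib_left[symmetric] sum.distrib[symmetric]
  by (intro mult_left_mono sum_mono) auto

lemma avg_weight_scale: "avg_weight p (c *\<^sub>R a) A = \<bar>c\<bar> * avg_weight p a A"
  by (simp add: avg_weight_def scaleR_fun_def abs_mult sum_distrib_left mult_ac)

lemma avg_weight_singleton: "avg_weight p a {k} = \<bar>a k\<bar>"
  by (simp add: avg_weight_def)

lemma avg_weight_le_norm:
  assumes "1 < p" "a \<in> weak_lp p" "finite A" "A \<noteq> {}"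
  shows "avg_weight p a A \<le> weak_lp_norm p a"
  unfolding weak_lp_norm_def using assms by (intro cSUP_upper) (auto simp: weak_lp_iff)

lemma weak_lp_norm_le:
  assumes "\<And>A. finite A \<Longrightarrow> A \<noteq> {} \<Longrightarrow> avg_weight p a A \<le> m"
  shows "weak_lp_norm p a \<le> m"
  unfolding weak_lp_norm_def using assms by (intro cSUP_least) auto

lemma weak_lp_I:
  assumes "1 < p" "a \<longlonglongrightarrow> 0" "\<And>A. finite A \<Longrightarrow> A \<noteq> {} \<Longrightarrow> avg_weight p a A \<le> m"
  shows "a \<in> weak_lp p"
  using assms by (auto simp: weak_lp_iff intro!: bdd_aboveI2)

lemma weak_lp_add:
  assumes p: "1 < p" and "a \<in> weak_lp p" "b \<in> weak_lp p"
  shows "a + b \<in> weak_lp p" "weak_lp_norm p (a + b) \<le> weak_lp_norm p a + weak_lp_norm p b"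
proof -
  have *: "avg_weight p (a + b) A \<le> weak_lp_norm p a + weak_lp_norm p b"
    if "finite A" "A \<noteq> {}" for A
    using avg_weight_add[of p a b A] avg_weight_le_norm[OF p _ that] assms
    by (meson add_mono order_trans)
  have "(a + b) \<longlonglongrightarrow> 0"
    using assms tendsto_add[of a 0 _ b 0] by (auto simp: weak_lp_iff plus_fun_def)
  then show "a + b \<in> weak_lp p" using * by (intro weak_lp_I[OF p]) auto
  show "weak_lp_norm p (a + b) \<le> weak_lp_norm p a + weak_lp_norm p b"
    using * by (rule weak_lp_norm_le)
qed

lemma weak_lp_scale:
  assumes p: "1 < p" and a: "a \<in> weak_lp p"
  shows "c *\<^sub>R a \<in> weak_lp p" "weak_lp_norm p (c *\<^sub>R a) \<le> \<bar>c\<bar> * weak_lp_norm p a"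
proof -
  have *: "avg_weight p (c *\<^sub>R a) A \<le> \<bar>c\<bar> * weak_lp_norm p a" if "finite A" "A \<noteq> {}" for A
    unfolding avg_weight_scale using avg_weight_le_norm[OF p a that] by (simp add: mult_left_mono)
  have "(c *\<^sub>R a) \<longlonglongrightarrow> 0"
    using a p tendsto_mult_left[of a 0 _ c] by (auto simp: weak_lp_iff scaleR_fun_def)
  then show "c *\<^sub>R a \<in> weak_lp p" using * by (intro weak_lp_I[OF p]) auto
  show "weak_lp_norm p (c *\<^sub>R a) \<le> \<bar>c\<bar> * weak_lp_norm p a" using * by (rule weak_lp_norm_le)
qed

lemma subspace_weak_lp:
  assumes p: "1 < p"
  shows "subspace (weak_lp p)"
proof (rule subspaceI)
  show "0 \<in> weak_lp p"
    by (rule weak_lp_I[OF p, of _ 0]) (auto simp: avg_weight_def zero_fun_def)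
qed (use weak_lp_add[OF p] weak_lp_scale[OF p] in auto)

lemma abs_le_weak_lp_norm:
  assumes "1 < p" "a \<in> weak_lp p"
  shows "\<bar>a k\<bar> \<le> weak_lp_norm p a"
  using avg_weight_le_norm[OF assms, of "{k}"] by (simp add: avg_weight_singleton)

lemma norm_on_weak_lp:
  assumes p: "1 < p"
  shows "norm_on (weak_lp p) (weak_lp_norm p)"
  unfolding norm_on_def
proof (intro conjI ballI allI)
  show "subspace (weak_lp p)" by (rule subspace_weak_lp[OF p])
next
  fix a assume a: "a \<in> weak_lp p"
  show "0 \<le> weak_lp_norm p a" using abs_le_weak_lp_norm[OF p a, of 0] by linarith
  show "weak_lp_norm p a = 0 \<longleftrightarrow> a = 0"
  proof
    assume "weak_lp_norm p a = 0"
    then have "a k = 0" for k using abs_le_weak_lp_norm[OF p a, of k] by linarith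
    then show "a = 0" by auto
  next
    assume "a = 0"
    then have "weak_lp_norm p a \<le> 0"
      by (intro weak_lp_norm_le) (auto simp: avg_weight_def)
    then show "weak_lp_norm p a = 0" using \<open>0 \<le> weak_lp_norm p a\<close> by linarith
  qed
  fix c :: real
  show "weak_lp_norm p (c *\<^sub>R a) = \<bar>c\<bar> * weak_lp_norm p a"
  proof (cases "c = 0")
    case True
    have "weak_lp_norm p (c *\<^sub>R a) \<le> 0" using weak_lp_scale(2)[OF p a, of c] True by simp
    moreover have "0 \<le> weak_lp_norm p (c *\<^sub>R a)"
      using abs_le_weak_lp_norm[OF p weak_lp_scale(1)[OF p a, of c], of 0] by linarith
    ultimately show ?thesis using True by simp
  next
    case False
    have "weak_lp_norm p a \<le> \<bar>inverse c\<bar> * weak_lp_norm p (c *\<^sub>R a)"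
      using weak_lp_scale(2)[OF p weak_lp_scale(1)[OF p a, of c], of "inverse c"] False by simp
    then have "\<bar>c\<bar> * weak_lp_norm p a \<le> weak_lp_norm p (c *\<^sub>R a)"
      using False by (simp add: field_simps)
    then show ?thesis using weak_lp_scale(2)[OF p a, of c] by simp
  qed
next
  fix a b assume "a \<in> weak_lp p" "b \<in> weak_lp p"
  then show "weak_lp_norm p (a + b) \<le> weak_lp_norm p a + weak_lp_norm p b"
    by (rule weak_lp_add(2)[OF p])
qed

lemma banach_space_on_weak_lp:
  assumes p: "1 < p"
  shows "banach_space_on (weak_lp p) (weak_lp_norm p)"
  unfolding banach_space_on_def
proof (intro conjI allI impI norm_on_weak_lp[OF p], elim conjE)
  fix \<sigma> :: "nat \<Rightarrow> nat \<Rightarrow> real"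
  assume "range \<sigma> \<subseteq> weak_lp p"
    and C: "\<forall>\<epsilon>>0. \<exists>n0. \<forall>m\<ge>n0. \<forall>n\<ge>n0. weak_lp_norm p (\<sigma> m - \<sigma> n) < \<epsilon>"
  then have \<sigma>: "\<sigma> n \<in> weak_lp p" for n by auto
  have diff: "\<sigma> m - \<sigma> n \<in> weak_lp p" for m n
    using \<sigma> subspace_weak_lp[OF p] by (simp add: subspace_diff)
  have "Cauchy (\<lambda>n. \<sigma> n k)" for k
  proof (rule CauchyI)
    fix e :: real assume "e > 0"
    then obtain n0 where "\<forall>m\<ge>n0. \<forall>n\<ge>n0. weak_lp_norm p (\<sigma> m - \<sigma> n) < e" using C by blast
    moreover have "norm (\<sigma> m k - \<sigma> n k) \<le> weak_lp_norm p (\<sigma> m - \<sigma> n)" for m n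
      using abs_le_weak_lp_norm[OF p diff, of m n k] by simp
    ultimately show "\<exists>M. \<forall>m\<ge>M. \<forall>n\<ge>M. norm (\<sigma> m k - \<sigma> n k) < e"
      by (meson le_less_trans)
  qed
  then have "\<exists>l. (\<lambda>n. \<sigma> n k) \<longlonglongrightarrow> l" for k
    using Cauchy_convergent_iff convergent_def by blast
  then obtain l where l: "\<And>k. (\<lambda>n. \<sigma> n k) \<longlonglongrightarrow> l k" by metis
  have close: "\<exists>n0. \<forall>n\<ge>n0. \<forall>A. finite A \<and> A \<noteq> {} \<longrightarrow> avg_weight p (\<sigma> n - l) A \<le> \<epsilon>"
    if e: "\<epsilon> > 0" for \<epsilon>
  proof -
    obtain n0 where n0: "\<forall>m\<ge>n0. \<forall>n\<ge>n0. weak_lp_norm p (\<sigma> m - \<sigma> n) < \<epsilon>" using C e by blast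
    have "avg_weight p (\<sigma> n - l) A \<le> \<epsilon>" if "n \<ge> n0" "finite A" "A \<noteq> {}" for n A
    proof (rule LIMSEQ_le_const2)
      show "(\<lambda>m. avg_weight p (\<sigma> n - \<sigma> m) A) \<longlonglongrightarrow> avg_weight p (\<sigma> n - l) A"
        unfolding avg_weight_def minus_apply by (intro tendsto_intros l)
      have "avg_weight p (\<sigma> n - \<sigma> m) A \<le> \<epsilon>" if "m \<ge> n0" for m
        using avg_weight_le_norm[OF p diff \<open>finite A\<close> \<open>A \<noteq> {}\<close>, of n m] n0 that \<open>n \<ge> n0\<close>
        by (meson less_imp_le order_trans)
      then show "\<exists>N. \<forall>m\<ge>N. avg_weight p (\<sigma> n - \<sigma> m) A \<le> \<epsilon>" by blast
    qed
    then show ?thesis by blast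
  qed
  have "l \<longlonglongrightarrow> 0"
  proof (rule LIMSEQ_I)
    fix r :: real assume "r > 0"
    then obtain n where n: "\<And>A. finite A \<Longrightarrow> A \<noteq> {} \<Longrightarrow> avg_weight p (\<sigma> n - l) A \<le> r / 2"
      using close[of "r / 2"] by auto
    have 1: "\<bar>\<sigma> n k - l k\<bar> \<le> r / 2" for k
      using n[of "{k}"] by (simp add: avg_weight_singleton)
    have "\<sigma> n \<longlonglongrightarrow> 0" using \<sigma> weak_lp_iff[OF p] by blast
    then obtain k0 where k0: "\<And>k. k \<ge> k0 \<Longrightarrow> \<bar>\<sigma> n k\<bar> < r / 2"
      using LIMSEQ_D[of "\<sigma> n" 0 "r / 2"] \<open>r > 0\<close> by auto
    then have "\<bar>l k\<bar> < r" if "k \<ge> k0" for k using 1[of k] k0[OF that] by linarith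
    then show "\<exists>no. \<forall>k\<ge>no. norm (l k - 0) < r" by auto
  qed
  have lim0: "(\<sigma> n - l) \<longlonglongrightarrow> 0" for n
    using tendsto_diff[of "\<sigma> n" 0 sequentially l 0] \<sigma> weak_lp_iff[OF p] \<open>l \<longlonglongrightarrow> 0\<close>
    by (auto simp: fun_diff_def)
  obtain n1 where "\<And>A. finite A \<Longrightarrow> A \<noteq> {} \<Longrightarrow> avg_weight p (\<sigma> n1 - l) A \<le> 1"
    using close[of 1] by auto
  then have "\<sigma> n1 - l \<in> weak_lp p" using lim0 by (intro weak_lp_I[OF p, of _ 1]) auto
  then have "\<sigma> n1 - (\<sigma> n1 - l) \<in> weak_lp p"
    using \<sigma> subspace_weak_lp[OF p] subspace_diff by blast
  then have L: "l \<in> weak_lp p" by simp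
  have "(\<lambda>n. weak_lp_norm p (\<sigma> n - l)) \<longlonglongrightarrow> 0"
  proof (rule LIMSEQ_I)
    fix r :: real assume "r > 0"
    then obtain n0 where n0: "\<forall>n\<ge>n0. \<forall>A. finite A \<and> A \<noteq> {} \<longrightarrow> avg_weight p (\<sigma> n - l) A \<le> r / 2"
      using close[of "r / 2"] by auto
    have "norm (weak_lp_norm p (\<sigma> n - l) - 0) < r" if "n \<ge> n0" for n
    proof -
      have "weak_lp_norm p (\<sigma> n - l) \<le> r / 2" using n0 that by (intro weak_lp_norm_le) auto
      moreover have "0 \<le> weak_lp_norm p (\<sigma> n - l)"
        using abs_le_weak_lp_norm[OF p, of "\<sigma> n - l" 0] \<sigma> L subspace_weak_lp[OF p] subspace_diff
        by fastforce
      ultimately show ?thesis using \<open>r > 0\<close> by simp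
    qed
    then show "\<exists>no. \<forall>n\<ge>no. norm (weak_lp_norm p (\<sigma> n - l) - 0) < r" by blast
  qed
  then show "\<exists>l\<in>weak_lp p. (\<lambda>n. weak_lp_norm p (\<sigma> n - l)) \<longlonglongrightarrow> 0" using L by blast
qed

lemma weak_lp_equivalent_norm_exists:
  assumes p: "1 < p"
  shows "\<exists>N. weak_lp_equivalent_norm p N"
proof -
  let ?C = "1 / (1 - 1 / p)"
  have C: "?C \<ge> 1" using p by (simp add: field_simps)
  have "inverse ?C * weak_lp_qnorm p a \<le> weak_lp_norm p a \<and>
        weak_lp_norm p a \<le> ?C * weak_lp_qnorm p a" if a: "a \<in> weak_lp p" for a
  proof
    have lim: "a \<longlonglongrightarrow> 0" using a by (simp add: weak_lp_def)
    have up: "decreasing_rearrangement a n * real (n + 1) powr (1 / p) \<le> weak_lp_qnorm p a" for n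
      using a unfolding weak_lp_qnorm_def weak_lp_def by (intro cSUP_upper) auto
    show "weak_lp_norm p a \<le> ?C * weak_lp_qnorm p a"
      using avg_weight_upper[OF p lim up] by (intro weak_lp_norm_le) auto
    have "weak_lp_qnorm p a \<le> weak_lp_norm p a"
      unfolding weak_lp_qnorm_def
      using avg_weight_lower[OF lim avg_weight_le_norm[OF p a]] by (intro cSUP_least) auto
    moreover have "0 \<le> weak_lp_norm p a" using abs_le_weak_lp_norm[OF p a, of 0] by linarith
    moreover have "0 \<le> inverse ?C" "inverse ?C \<le> 1"
      using p by auto
    ultimately show "inverse ?C * weak_lp_qnorm p a \<le> weak_lp_norm p a"
      by (meson mult_left_le_one_le mult_left_mono order_trans)
  qed
  then show ?thesis
    unfolding weak_lp_equivalent_norm_def using banach_space_on_weak_lp[OF p] C by blast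
qed

end

theory Submission
  imports Defs
begin

text \<open>
  Write \<open>X\<close> for the separable part and \<open>e\<close> for its unit vector basis. An element of weak \<open>\<ell>\<^sub>p\<close> lies
  in \<open>X\<close> precisely when its averages over large sets are negligible (\<open>separable_part_iff\<close>). That \<open>e\<close>
  is greedy follows by comparing the norm with a rearrangement invariant one
  (\<open>greedy_basis_unit_seq\<close>). It remains to show that a greedy basis \<open>x\<close> of \<open>X\<close>, with coefficient
  functionals \<open>x\<^sup>*\<close>, is equivalent to \<open>e\<close>.

  The greedy condition makes \<open>x\<close> unconditional and democratic (\<open>suppression_unconditional\<close>,
  \<open>democratic\<close>). Unconditionality allows an average over signs that bounds the diagonal of a
  matrix by the matrix (\<open>diagonal\<close>), and this is the main tool. Suppose that there are \<open>\<delta> > 0\<close>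
  and coordinates \<open>h k\<close> such that \<open>\<bar>e\<^sup>*\<^bsub>h k\<^esub>(x\<^sub>k)\<bar> \<ge> \<delta>\<close> and \<open>\<bar>x\<^sup>*\<^sub>k(e\<^bsub>h k\<^esub>)\<bar> \<ge> \<delta>\<close> for all \<open>k\<close>. On
  a set of indices where \<open>h\<close> is injective, the diagonals of the two matrices that express \<open>e\<close> through
  \<open>x\<close> and \<open>x\<close> through \<open>e\<close> then give the upper and the lower estimate against \<open>e\<close>, whose norm does not
  depend on the order of the coordinates. Finitely many such sets cover all indices, because a
  coordinate shared by many \<open>k\<close> gives \<open>\<parallel>e\<^sub>n\<parallel> \<ge> const * \<delta> * \<parallel>\<Sum>k\<in>F. x\<^sub>k\<parallel>\<close> with \<open>F\<close> large
  (\<open>bounded_multiplicity\<close>).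

  Both this and the existence of \<open>h\<close> rest on the fact that the sums \<open>\<Sum>k\<in>F. x\<^sub>k\<close> are unbounded
  (\<open>indicator_sums_unbounded\<close>). Otherwise \<open>x\<close> spans a copy of \<open>c\<^sub>0\<close>, in which a gliding hump finds
  many unit vectors with bounded sum, although \<open>m\<close> unit vectors add up to norm about
  \<open>m powr (1 / p)\<close>. If no \<open>\<delta>\<close> worked, then for suitable \<open>k\<close> the entries of \<open>x\<^sub>k\<close> could be cut off
  at a small level while \<open>x\<^sup>*\<^sub>k\<close> keeps at least the value \<open>1 / 2\<close> on the remainder \<open>y\<^sub>k\<close>
  (\<open>small_piece\<close>). Elements of \<open>X\<close> with bounded norms, and with entries
  that decrease rapidly from one element to the next, add up like in \<open>c\<^sub>0\<close> (\<open>norm_add_small_entries\<close>), and the diagonal of the matrix \<open>x\<^sup>*\<^sub>i(y\<^sub>k)\<close> transfers the bound to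
  sums of the \<open>x\<^sub>k\<close>, a contradiction (\<open>common_large_coordinate\<close>).
\<close>

section \<open>Signs and multipliers\<close>

locale normed_subspace =
  fixes X :: "'v::real_vector set" and N :: "'v \<Rightarrow> real"
  assumes norm_on: "norm_on X N"
begin

lemma subspace: "subspace X"
  and N_nonneg: "v \<in> X \<Longrightarrow> 0 \<le> N v"
  and N_eq_0_iff: "v \<in> X \<Longrightarrow> N v = 0 \<longleftrightarrow> v = 0"
  and N_scale: "v \<in> X \<Longrightarrow> N (c *\<^sub>R v) = \<bar>c\<bar> * N v"
  and N_add: "u \<in> X \<Longrightarrow> v \<in> X \<Longrightarrow> N (u + v) \<le> N u + N v"
  using norm_on by (auto simp: norm_on_def)

lemmas closed_intros =
  subspace_add[OF subspace] subspace_diff[OF subspace] subspace_scale[OF subspace]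
  subspace_0[OF subspace] subspace_sum[OF subspace]

lemma N_minus: "v \<in> X \<Longrightarrow> N (- v) = N v"
  using N_scale[of v "-1"] by simp

lemma N_diff: "u \<in> X \<Longrightarrow> v \<in> X \<Longrightarrow> N (u - v) \<le> N u + N v"
  using N_add[of u "- v"] N_minus[of v] closed_intros(3)[of v "-1"] by simp

lemma N_sum: "(\<And>i. i \<in> I \<Longrightarrow> u i \<in> X) \<Longrightarrow> N (\<Sum>i\<in>I. u i) \<le> (\<Sum>i\<in>I. N (u i))"
proof (induction I rule: infinite_finite_induct)
  case (insert i I)
  then have "N (u i + sum u I) \<le> N (u i) + N (sum u I)"
    by (intro N_add closed_intros) auto
  with insert show ?case by fastforce
qed (use N_eq_0_iff[of 0] closed_intros(4) in auto)

lemma N_between: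
  assumes "z \<in> X" "u \<in> X" "N (z + u) \<le> M" "N (z - u) \<le> M" "\<bar>b\<bar> \<le> 1"
  shows "N (z + b *\<^sub>R u) \<le> M"
proof -
  have "z + b *\<^sub>R u = ((1 + b) / 2) *\<^sub>R (z + u) + ((1 - b) / 2) *\<^sub>R (z - u)"
  proof -
    have "(1 + b) / 2 + (1 - b) / 2 = 1" "(1 + b) / 2 - (1 - b) / 2 = b" by (simp_all add: field_simps)
    then have "z + b *\<^sub>R u =
        ((1 + b) / 2 + (1 - b) / 2) *\<^sub>R z + ((1 + b) / 2 - (1 - b) / 2) *\<^sub>R u" by simp
    then show ?thesis
      by (simp only: scaleR_add_left scaleR_add_right scaleR_diff_left scaleR_diff_right) simp
  qed
  also have "N \<dots> \<le> \<bar>(1 + b) / 2\<bar> * N (z + u) + \<bar>(1 - b) / 2\<bar> * N (z - u)"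
    using N_add[of "((1 + b) / 2) *\<^sub>R (z + u)" "((1 - b) / 2) *\<^sub>R (z - u)"] assms(1,2)
    by (simp add: N_scale closed_intros)
  also have "\<dots> \<le> \<bar>(1 + b) / 2\<bar> * M + \<bar>(1 - b) / 2\<bar> * M"
    using assms by (intro add_mono mult_left_mono) auto
  also have "\<dots> = M" using assms(5) by (simp add: abs_le_iff field_simps)
  finally show ?thesis .
qed

text \<open>The cube of multipliers is the convex hull of the sign vectors.\<close>

lemma multiplier_bound_from_signs:
  assumes "finite F" "\<And>k. u k \<in> X" "z \<in> X"
    and "\<And>\<epsilon> :: 'i \<Rightarrow> real. (\<And>k. \<bar>\<epsilon> k\<bar> = 1) \<Longrightarrow> N (z + (\<Sum>k\<in>F. \<epsilon> k *\<^sub>R u k)) \<le> M"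
    and "\<And>k. \<bar>b k\<bar> \<le> 1"
  shows "N (z + (\<Sum>k\<in>F. b k *\<^sub>R u k)) \<le> M"
  using assms(1,3,4)
proof (induction F arbitrary: z rule: finite_induct)
  case empty
  show ?case using empty(2)[of "\<lambda>_. 1"] by simp
next
  case (insert i F)
  have *: "N ((z + s *\<^sub>R u i) + (\<Sum>k\<in>F. b k *\<^sub>R u k)) \<le> M" if "\<bar>s\<bar> = 1" for s
  proof (rule insert.IH)
    show "z + s *\<^sub>R u i \<in> X" using insert assms(2) by (intro closed_intros)
    fix \<epsilon> :: "'i \<Rightarrow> real" assume \<epsilon>: "\<And>k. \<bar>\<epsilon> k\<bar> = 1"
    have "(\<Sum>k\<in>F. (\<epsilon>(i := s)) k *\<^sub>R u k) = (\<Sum>k\<in>F. \<epsilon> k *\<^sub>R u k)"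
      using insert.hyps by (intro sum.cong) auto
    then show "N (z + s *\<^sub>R u i + (\<Sum>k\<in>F. \<epsilon> k *\<^sub>R u k)) \<le> M"
      using insert.prems(2)[of "\<epsilon>(i := s)"] insert.hyps \<epsilon> that by (simp add: add.assoc)
  qed
  let ?z = "z + (\<Sum>k\<in>F. b k *\<^sub>R u k)"
  have "N (?z + b i *\<^sub>R u i) \<le> M"
  proof (rule N_between)
    show "?z \<in> X" using insert assms(2) by (intro closed_intros)
    show "N (?z + u i) \<le> M" "N (?z - u i) \<le> M"
      using *[of 1] *[of "-1"] by (simp_all add: algebra_simps)
  qed (use assms in auto)
  then show ?case using insert.hyps by (simp add: algebra_simps)
qed

text \<open>Averaging over all signs kills the off-diagonal terms of a matrix of vectors, because
  \<open>\<epsilon> i * \<epsilon> j\<close> has mean \<open>0\<close> for \<open>i \<noteq> j\<close>. The induction averages over one sign at a time.\<close>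

lemma sign_average_diagonal:
  assumes "finite F" "\<And>i j. V i j \<in> X" "z \<in> X"
    and "\<And>\<epsilon> :: 'i \<Rightarrow> real. (\<And>k. \<bar>\<epsilon> k\<bar> = 1) \<Longrightarrow>
      N (z + (\<Sum>i\<in>F. \<Sum>j\<in>F. (\<epsilon> i * \<epsilon> j) *\<^sub>R V i j)) \<le> M"
  shows "N (z + (\<Sum>i\<in>F. V i i)) \<le> M"
  using assms(1,3,4)
proof (induction F arbitrary: z rule: finite_induct)
  case empty
  show ?case using empty(2)[of "\<lambda>_. 1"] by simp
next
  case (insert k F)
  have "N ((z + V k k) + (\<Sum>i\<in>F. V i i)) \<le> M"
  proof (rule insert.IH)
    show "z + V k k \<in> X" using insert assms(2) by (intro closed_intros)
    fix \<epsilon> :: "'i \<Rightarrow> real" assume \<epsilon>: "\<And>k. \<bar>\<epsilon> k\<bar> = 1"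
    define D where "D = (\<Sum>i\<in>F. \<Sum>j\<in>F. (\<epsilon> i * \<epsilon> j) *\<^sub>R V i j)"
    define w where "w = (\<Sum>j\<in>F. \<epsilon> j *\<^sub>R V k j) + (\<Sum>i\<in>F. \<epsilon> i *\<^sub>R V i k)"
    have *: "N ((z + V k k + D) + s *\<^sub>R w) \<le> M" if s: "\<bar>s\<bar> = 1" for s
    proof -
      let ?e = "\<epsilon>(k := s)"
      have ss: "s * s = 1" using s by (metis abs_mult_self_eq mult_1)
      have "(\<Sum>i\<in>insert k F. \<Sum>j\<in>insert k F. (?e i * ?e j) *\<^sub>R V i j) =
          (s * s) *\<^sub>R V k k + (\<Sum>j\<in>F. (s * ?e j) *\<^sub>R V k j)
          + (\<Sum>i\<in>F. (?e i * s) *\<^sub>R V i k + (\<Sum>j\<in>F. (?e i * ?e j) *\<^sub>R V i j))"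
        using insert.hyps by simp
      also have "(\<Sum>j\<in>F. (s * ?e j) *\<^sub>R V k j) = (\<Sum>j\<in>F. (s * \<epsilon> j) *\<^sub>R V k j)"
        using insert.hyps by (intro sum.cong) auto
      also have "(\<Sum>i\<in>F. (?e i * s) *\<^sub>R V i k + (\<Sum>j\<in>F. (?e i * ?e j) *\<^sub>R V i j)) =
          (\<Sum>i\<in>F. (\<epsilon> i * s) *\<^sub>R V i k + (\<Sum>j\<in>F. (\<epsilon> i * \<epsilon> j) *\<^sub>R V i j))"
        using insert.hyps by (intro sum.cong arg_cong2[where f="(+)"]) auto
      also have "(s * s) *\<^sub>R V k k + (\<Sum>j\<in>F. (s * \<epsilon> j) *\<^sub>R V k j) + \<dots> = V k k + D + s *\<^sub>R w"
        by (simp add: ss D_def w_def sum.distrib scaleR_add_right scaleR_sum_right mult.commute)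
      finally show ?thesis
        using insert.prems(2)[of ?e] \<epsilon> s by (simp add: add.assoc)
    qed
    have "N ((z + V k k + D) + 0 *\<^sub>R w) \<le> M"
    proof (rule N_between)
      show "z + V k k + D \<in> X" "w \<in> X"
        unfolding D_def w_def using insert.prems(1) assms(2) by (auto intro!: closed_intros)
      show "N (z + V k k + D + w) \<le> M" "N (z + V k k + D - w) \<le> M"
        using *[of 1] *[of "-1"] by simp_all
    qed auto
    then show "N (z + V k k + D) \<le> M" by simp
  qed
  then show ?case using insert.hyps by (simp add: algebra_simps)
qed

end

text \<open>The coordinates \<open>f v\<close> relative to an unconditional basis, as far as bounded multipliers act on
  them. It is used for the given greedy basis as well as for the unit vectors.\<close>

locale unconditional_system = normed_subspace X N
  for X :: "'v::real_vector set" and N +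
  fixes x :: "nat \<Rightarrow> 'v" and f :: "'v \<Rightarrow> nat \<Rightarrow> real" and K :: real
  assumes x_in: "x k \<in> X"
    and f_add: "u \<in> X \<Longrightarrow> v \<in> X \<Longrightarrow> f (u + v) k = f u k + f v k"
    and f_scale: "v \<in> X \<Longrightarrow> f (c *\<^sub>R v) k = c * f v k"
    and K_ge_1: "1 \<le> K"
    and multiplier: "finite F \<Longrightarrow> v \<in> X \<Longrightarrow> (\<And>k. \<bar>b k\<bar> \<le> 1) \<Longrightarrow>
      N (\<Sum>k\<in>F. (b k * f v k) *\<^sub>R x k) \<le> K * N v"
begin

lemma f_0: "f 0 k = 0"
  using f_scale[of 0 0 k] closed_intros(4) by simp

lemma f_sum: "(\<And>i. i \<in> I \<Longrightarrow> u i \<in> X) \<Longrightarrow> f (\<Sum>i\<in>I. u i) k = (\<Sum>i\<in>I. f (u i) k)"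
proof (induction I rule: infinite_finite_induct)
  case (insert i I)
  then have "f (u i + sum u I) k = f (u i) k + f (sum u I) k"
    by (intro f_add closed_intros) auto
  with insert show ?case by simp
qed (use f_0 in auto)

lemma span_in: "(\<Sum>k\<in>F. a k *\<^sub>R x (g k)) \<in> X"
  by (intro closed_intros x_in)

text \<open>The quotients \<open>a k / (s * f v k)\<close> are admissible multipliers.\<close>

lemma dominated_coefficients:
  assumes "finite F" "v \<in> X" "0 < s" "\<And>k. k \<in> F \<Longrightarrow> \<bar>a k\<bar> \<le> s * \<bar>f v k\<bar>"
  shows "N (\<Sum>k\<in>F. a k *\<^sub>R x k) \<le> s * K * N v"
proof -
  define b where "b k = (if k \<in> F then a k / (s * f v k) else 0)" for k
  have "\<bar>b k\<bar> \<le> 1" for k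
    using assms(3) assms(4)[of k]
    by (cases "f v k = 0") (auto simp: b_def abs_mult divide_le_eq)
  then have "N (\<Sum>k\<in>F. (b k * f (s *\<^sub>R v) k) *\<^sub>R x k) \<le> K * N (s *\<^sub>R v)"
    using assms by (intro multiplier closed_intros) auto
  also have "(\<Sum>k\<in>F. (b k * f (s *\<^sub>R v) k) *\<^sub>R x k) = (\<Sum>k\<in>F. a k *\<^sub>R x k)"
  proof (rule sum.cong[OF refl])
    fix k assume "k \<in> F"
    then show "(b k * f (s *\<^sub>R v) k) *\<^sub>R x k = a k *\<^sub>R x k"
      using assms(3) assms(4)[of k] by (cases "f v k = 0") (auto simp: b_def f_scale[OF assms(2)])
  qed
  finally show ?thesis using assms by (simp add: N_scale mult_ac)
qed

lemma coefficient_bound: "v \<in> X \<Longrightarrow> \<bar>f v k\<bar> * N (x k) \<le> K * N v"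
  using dominated_coefficients[of "{k}" v 1 "f v"] x_in by (simp add: N_scale)

text \<open>The diagonal of an operator between spaces with unconditional bases is bounded: here the
  operator sends the \<open>j\<close>-th unit vector to \<open>y j\<close>, and row \<open>g j\<close> is matched with column \<open>j\<close>.\<close>

lemma diagonal:
  assumes F: "finite F" "inj_on g F" and y: "\<And>j. y j \<in> X"
    and M: "\<And>\<epsilon> :: nat \<Rightarrow> real. (\<And>k. \<bar>\<epsilon> k\<bar> = 1) \<Longrightarrow> N (\<Sum>j\<in>F. \<epsilon> j *\<^sub>R y j) \<le> M"
  shows "N (\<Sum>j\<in>F. f (y j) (g j) *\<^sub>R x (g j)) \<le> K * M"
proof -
  define V where "V i j = f (y j) (g i) *\<^sub>R x (g i)" for i j
  have "N (0 + (\<Sum>i\<in>F. V i i)) \<le> K * M"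
  proof (rule sign_average_diagonal[OF F(1), where V=V])
    fix \<epsilon> :: "nat \<Rightarrow> real" assume \<epsilon>: "\<And>k. \<bar>\<epsilon> k\<bar> = 1"
    define u where "u = (\<Sum>j\<in>F. \<epsilon> j *\<^sub>R y j)"
    have u: "u \<in> X" unfolding u_def using y by (intro closed_intros)
    have fu: "f u k = (\<Sum>j\<in>F. \<epsilon> j * f (y j) k)" for k
      unfolding u_def using y by (simp add: f_sum f_scale closed_intros)
    have "(\<Sum>i\<in>F. \<Sum>j\<in>F. (\<epsilon> i * \<epsilon> j) *\<^sub>R V i j) = (\<Sum>i\<in>F. (\<epsilon> i * f u (g i)) *\<^sub>R x (g i))"
      unfolding V_def fu
      by (simp add: sum_distrib_left scaleR_sum_left mult.assoc)
    also have "\<dots> = (\<Sum>k\<in>g ` F. (\<epsilon> (the_inv_into F g k) * f u k) *\<^sub>R x k)"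
      using F(2) by (simp add: sum.reindex the_inv_into_f_f)
    also have "N \<dots> \<le> K * N u" using F(1) u \<epsilon> by (intro multiplier) auto
    also have "\<dots> \<le> K * M" using M[of \<epsilon>] \<epsilon> K_ge_1 by (intro mult_left_mono) (auto simp: u_def)
    finally show "N (0 + (\<Sum>i\<in>F. \<Sum>j\<in>F. (\<epsilon> i * \<epsilon> j) *\<^sub>R V i j)) \<le> K * M" by simp
  qed (use x_in in \<open>auto simp: V_def intro!: closed_intros\<close>)
  then show ?thesis by (simp add: V_def)
qed

end

section \<open>Greedy bases are unconditional and democratic\<close>

locale normed_greedy_basis = normed_subspace X N
  for X :: "'v::real_vector set" and N +
  fixes x :: "nat \<Rightarrow> 'v"
  assumes greedy: "greedy_basis X N x"
begin

abbreviation coeff :: "'v \<Rightarrow> nat \<Rightarrow> real" where "coeff \<equiv> basis_coeff N x"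

lemma basis_in: "x k \<in> X"
  using greedy by (auto simp: greedy_basis_def schauder_basis_def)

lemma partial_sum_in: "(\<Sum>k\<in>F. a k *\<^sub>R x k) \<in> X"
  by (intro closed_intros basis_in)

lemma coeff_unique:
  assumes "v \<in> X" "(\<lambda>n. N (v - (\<Sum>k<n. a k *\<^sub>R x k))) \<longlonglongrightarrow> 0"
  shows "coeff v = a"
proof -
  have "\<exists>!a. (\<lambda>n. N (v - (\<Sum>k<n. a k *\<^sub>R x k))) \<longlonglongrightarrow> 0"
    using greedy assms(1) by (auto simp: greedy_basis_def schauder_basis_def)
  then show ?thesis using assms(2) unfolding basis_coeff_def by (intro the1_equality)
qed

lemma expansion:
  assumes "v \<in> X"
  shows "(\<lambda>n. N (v - (\<Sum>k<n. coeff v k *\<^sub>R x k))) \<longlonglongrightarrow> 0"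
proof -
  have "\<exists>!a. (\<lambda>n. N (v - (\<Sum>k<n. a k *\<^sub>R x k))) \<longlonglongrightarrow> 0"
    using greedy assms(1) by (auto simp: greedy_basis_def schauder_basis_def)
  then show ?thesis unfolding basis_coeff_def by (rule theI')
qed

lemma coeff_add:
  assumes "u \<in> X" "v \<in> X"
  shows "coeff (u + v) k = coeff u k + coeff v k"
proof -
  let ?r = "\<lambda>w n. w - (\<Sum>k<n. coeff w k *\<^sub>R x k)"
  have "coeff (u + v) = (\<lambda>k. coeff u k + coeff v k)"
  proof (rule coeff_unique)
    have eq: "(u + v) - (\<Sum>k<n. (coeff u k + coeff v k) *\<^sub>R x k) = ?r u n + ?r v n" for n
      by (simp add: scaleR_add_left sum.distrib)
    have "(\<lambda>n. N (?r u n + ?r v n)) \<longlonglongrightarrow> 0"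
    proof (rule tendsto_sandwich[of "\<lambda>_. 0" _ _ "\<lambda>n. N (?r u n) + N (?r v n)"])
      show "(\<lambda>n. N (?r u n) + N (?r v n)) \<longlonglongrightarrow> 0"
        using tendsto_add[OF expansion[OF assms(1)] expansion[OF assms(2)]] by simp
    qed (use assms basis_in in
        \<open>auto intro!: always_eventually N_add N_nonneg closed_intros\<close>)
    then show "(\<lambda>n. N ((u + v) - (\<Sum>k<n. (coeff u k + coeff v k) *\<^sub>R x k))) \<longlonglongrightarrow> 0"
      unfolding eq .
  qed (use assms in \<open>intro closed_intros\<close>)
  then show ?thesis by simp
qed

lemma coeff_scale:
  assumes "v \<in> X"
  shows "coeff (c *\<^sub>R v) k = c * coeff v k"
proof -
  have "coeff (c *\<^sub>R v) = (\<lambda>k. c * coeff v k)"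
  proof (rule coeff_unique)
    have "N (c *\<^sub>R v - (\<Sum>k<n. (c * coeff v k) *\<^sub>R x k)) =
        \<bar>c\<bar> * N (v - (\<Sum>k<n. coeff v k *\<^sub>R x k))" for n
      using N_scale[of "v - (\<Sum>k<n. coeff v k *\<^sub>R x k)" c] assms partial_sum_in
      by (simp add: closed_intros scaleR_diff_right scaleR_sum_right)
    then show "(\<lambda>n. N (c *\<^sub>R v - (\<Sum>k<n. (c * coeff v k) *\<^sub>R x k))) \<longlonglongrightarrow> 0"
      using tendsto_mult_right_zero[OF expansion[OF assms], of "\<bar>c\<bar>"] by simp
  qed (use assms in \<open>intro closed_intros\<close>)
  then show ?thesis by simp
qed

lemma coeff_finite_sum:
  assumes "finite F"
  shows "coeff (\<Sum>k\<in>F. a k *\<^sub>R x k) = (\<lambda>k. if k \<in> F then a k else 0)"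
proof (rule coeff_unique[OF partial_sum_in])
  obtain m where m: "F \<subseteq> {..<m}" using finite_nat_iff_bounded[of F] assms by auto
  have "(\<Sum>k<n. (if k \<in> F then a k else 0) *\<^sub>R x k) = (\<Sum>k\<in>F. a k *\<^sub>R x k)" if "m \<le> n" for n
    using m that by (intro sum.mono_neutral_cong_right) auto
  then have "N ((\<Sum>k\<in>F. a k *\<^sub>R x k) - (\<Sum>k<n. (if k \<in> F then a k else 0) *\<^sub>R x k)) = 0"
    if "m \<le> n" for n
    using that N_eq_0_iff[of 0] closed_intros(4) by simp
  then show "(\<lambda>n. N ((\<Sum>k\<in>F. a k *\<^sub>R x k)
      - (\<Sum>k<n. (if k \<in> F then a k else 0) *\<^sub>R x k))) \<longlonglongrightarrow> 0"
    by (intro tendsto_eventually eventually_sequentiallyI[of m])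
qed

lemma semi_normalized_bounds:
  obtains c R where "0 < c" "\<And>k. c \<le> N (x k)" "\<And>k. N (x k) \<le> R"
proof -
  have s: "0 < (INF n. N (x n))" "bdd_above (range (\<lambda>n. N (x n)))"
    using greedy by (auto simp: greedy_basis_def semi_normalized_def)
  have "(INF n. N (x n)) \<le> N (x k)" for k
    using basis_in N_nonneg by (intro cINF_lower bdd_belowI2[of _ 0]) auto
  moreover obtain R where "\<And>k. N (x k) \<le> R" using s(2) by (auto simp: bdd_above_def)
  ultimately show ?thesis using s(1) that by blast
qed

lemma coeff_tendsto_0:
  assumes "v \<in> X"
  shows "coeff v \<longlonglongrightarrow> 0"
proof -
  obtain c R where c: "0 < c" "\<And>k. c \<le> N (x k)" using semi_normalized_bounds by metis
  let ?r = "\<lambda>n. v - (\<Sum>k<n. coeff v k *\<^sub>R x k)"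
  have r: "?r n \<in> X" for n using assms basis_in by (intro closed_intros)
  have *: "\<bar>coeff v n\<bar> \<le> (N (?r n) + N (?r (Suc n))) / c" for n
  proof -
    have "\<bar>coeff v n\<bar> * c \<le> \<bar>coeff v n\<bar> * N (x n)" by (intro mult_left_mono c) auto
    also have "\<dots> = N (?r n - ?r (Suc n))" using N_scale[OF basis_in, of "coeff v n" n] by simp
    also have "\<dots> \<le> N (?r n) + N (?r (Suc n))" by (intro N_diff r)
    finally show ?thesis using c by (simp add: field_simps)
  qed
  have "(\<lambda>n. (N (?r n) + N (?r (Suc n))) / c) \<longlonglongrightarrow> (0 + 0) / c"
    using expansion[OF assms] c by (intro tendsto_intros LIMSEQ_Suc) auto
  then have "(\<lambda>n. (N (?r n) + N (?r (Suc n))) / c) \<longlonglongrightarrow> 0" by simp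
  then show ?thesis by (rule Lim_null_comparison[rotated]) (use * in auto)
qed

lemma greedy_estimate:
  obtains C where "1 \<le> C"
    "\<And>v \<Lambda> A \<alpha>. v \<in> X \<Longrightarrow> finite \<Lambda> \<Longrightarrow> \<Lambda> \<noteq> {} \<Longrightarrow>
      (\<And>n m. n \<in> \<Lambda> \<Longrightarrow> m \<notin> \<Lambda> \<Longrightarrow> \<bar>coeff v m\<bar> \<le> \<bar>coeff v n\<bar>) \<Longrightarrow> card A = card \<Lambda> \<Longrightarrow>
      N (v - (\<Sum>n\<in>\<Lambda>. coeff v n *\<^sub>R x n)) \<le> C * N (v - (\<Sum>n\<in>A. \<alpha> n *\<^sub>R x n))"
proof -
  obtain C where C: "\<forall>v\<in>X. \<forall>\<Lambda>. finite \<Lambda> \<and> \<Lambda> \<noteq> {} \<and>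
        (\<forall>n\<in>\<Lambda>. \<forall>m. m \<notin> \<Lambda> \<longrightarrow> \<bar>coeff v m\<bar> \<le> \<bar>coeff v n\<bar>)
        \<longrightarrow> N (v - (\<Sum>n\<in>\<Lambda>. coeff v n *\<^sub>R x n))
            \<le> C * Inf {N (v - (\<Sum>n\<in>A. \<alpha> n *\<^sub>R x n)) | A \<alpha>. card A = card \<Lambda>}"
    using greedy unfolding greedy_basis_def by (elim conjE exE)
  show ?thesis
  proof (rule that[of "max 1 C"])
    fix v \<Lambda> and A :: "nat set" and \<alpha>
    assume v: "v \<in> X" and \<Lambda>: "finite \<Lambda>" "\<Lambda> \<noteq> {}"
      "\<And>n m. n \<in> \<Lambda> \<Longrightarrow> m \<notin> \<Lambda> \<Longrightarrow> \<bar>coeff v m\<bar> \<le> \<bar>coeff v n\<bar>" and A: "card A = card \<Lambda>"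
    let ?S = "{N (v - (\<Sum>n\<in>A. \<alpha> n *\<^sub>R x n)) | A \<alpha>. card A = card \<Lambda>}"
    have ge: "0 \<le> t" if "t \<in> ?S" for t
      using that v basis_in by (auto intro!: N_nonneg closed_intros)
    have mem: "N (v - (\<Sum>n\<in>A. \<alpha> n *\<^sub>R x n)) \<in> ?S" using A by blast
    have Inf: "0 \<le> Inf ?S" "Inf ?S \<le> N (v - (\<Sum>n\<in>A. \<alpha> n *\<^sub>R x n))"
      using mem ge by (auto intro!: cInf_greatest cInf_lower bdd_belowI[of _ 0])
    have "N (v - (\<Sum>n\<in>\<Lambda>. coeff v n *\<^sub>R x n)) \<le> C * Inf ?S"
      using C[rule_format, OF v, of \<Lambda>] \<Lambda> by simp
    also have "\<dots> \<le> max 1 C * Inf ?S" using Inf by (intro mult_right_mono) auto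
    also have "\<dots> \<le> max 1 C * N (v - (\<Sum>n\<in>A. \<alpha> n *\<^sub>R x n))"
      using Inf by (intro mult_left_mono) auto
    finally show "N (v - (\<Sum>n\<in>\<Lambda>. coeff v n *\<^sub>R x n))
        \<le> max 1 C * N (v - (\<Sum>n\<in>A. \<alpha> n *\<^sub>R x n))" .
  qed auto
qed

text \<open>To delete the part of \<open>v\<close> outside \<open>A\<close>, raise its coefficients by a large amount \<open>t\<close>.
  That part then is a greedy set, and subtracting \<open>t\<close> times its indicator, which gives \<open>v\<close> back,
  is one of the competing approximations.\<close>

lemma suppression_unconditional:
  obtains C where "1 \<le> C"
    "\<And>F A a. finite F \<Longrightarrow> A \<subseteq> F \<Longrightarrow>
      N (\<Sum>k\<in>A. a k *\<^sub>R x k) \<le> C * N (\<Sum>k\<in>F. a k *\<^sub>R x k)"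
proof -
  obtain C where C: "1 \<le> C"
    "\<And>v \<Lambda> A \<alpha>. v \<in> X \<Longrightarrow> finite \<Lambda> \<Longrightarrow> \<Lambda> \<noteq> {} \<Longrightarrow>
      (\<And>n m. n \<in> \<Lambda> \<Longrightarrow> m \<notin> \<Lambda> \<Longrightarrow> \<bar>coeff v m\<bar> \<le> \<bar>coeff v n\<bar>) \<Longrightarrow> card A = card \<Lambda> \<Longrightarrow>
      N (v - (\<Sum>n\<in>\<Lambda>. coeff v n *\<^sub>R x n)) \<le> C * N (v - (\<Sum>n\<in>A. \<alpha> n *\<^sub>R x n))"
    by (fact greedy_estimate)
  show ?thesis
  proof (rule that[OF C(1)])
    fix F A :: "nat set" and a :: "nat \<Rightarrow> real" assume F: "finite F" "A \<subseteq> F"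
    define B where "B = F - A"
    have FB: "F = A \<union> B" "A \<inter> B = {}" "finite A" "finite B"
      using F by (auto simp: B_def intro: finite_subset)
    show "N (\<Sum>k\<in>A. a k *\<^sub>R x k) \<le> C * N (\<Sum>k\<in>F. a k *\<^sub>R x k)"
    proof (cases "B = {}")
      case True
      then show ?thesis
        using FB C(1) N_nonneg[OF partial_sum_in, of a F] mult_right_mono[of 1 C] by simp
    next
      case False
      \<comment> \<open>The factor \<open>2\<close> makes \<open>a k + t\<close> at least \<open>t / 2\<close>, hence at least every \<open>\<bar>a m\<bar>\<close>.\<close>
      define t where "t = 2 * (\<Sum>k\<in>F. \<bar>a k\<bar>)"
      define a' where "a' k = a k + (if k \<in> B then t else 0)" for k
      define v where "v = (\<Sum>k\<in>F. a' k *\<^sub>R x k)"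
      have cv: "coeff v = (\<lambda>k. if k \<in> F then a' k else 0)"
        unfolding v_def by (rule coeff_finite_sum[OF F(1)])
      have a: "\<bar>a k\<bar> \<le> t / 2" if "k \<in> F" for k
        using member_le_sum[of k F "\<lambda>k. \<bar>a k\<bar>"] that F(1) by (simp add: t_def)
      have t: "0 \<le> t" unfolding t_def by (simp add: sum_nonneg)
      have "\<bar>coeff v m\<bar> \<le> \<bar>coeff v n\<bar>" if "n \<in> B" "m \<notin> B" for n m
        using a[of m] a[of n] that t FB(1) by (auto simp: cv a'_def)
      moreover have "v \<in> X" unfolding v_def by (rule partial_sum_in)
      ultimately have
        "N (v - (\<Sum>n\<in>B. coeff v n *\<^sub>R x n)) \<le> C * N (v - (\<Sum>n\<in>B. t *\<^sub>R x n))"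
        using C(2)[of v B B "\<lambda>_. t"] FB(4) False by blast
      moreover have "v - (\<Sum>n\<in>B. coeff v n *\<^sub>R x n) = (\<Sum>k\<in>A. a k *\<^sub>R x k)"
      proof -
        have "v = (\<Sum>k\<in>A. a' k *\<^sub>R x k) + (\<Sum>k\<in>B. a' k *\<^sub>R x k)"
          unfolding v_def FB(1) using FB by (intro sum.union_disjoint)
        moreover have "(\<Sum>k\<in>A. a' k *\<^sub>R x k) = (\<Sum>k\<in>A. a k *\<^sub>R x k)"
          using FB by (intro sum.cong) (auto simp: a'_def)
        moreover have "(\<Sum>k\<in>B. a' k *\<^sub>R x k) = (\<Sum>k\<in>B. coeff v k *\<^sub>R x k)"
          using FB by (intro sum.cong) (auto simp: cv)
        ultimately show ?thesis by (simp add: diff_eq_eq)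
      qed
      moreover have "v - (\<Sum>n\<in>B. t *\<^sub>R x n) = (\<Sum>k\<in>F. a k *\<^sub>R x k)"
      proof -
        have "v = (\<Sum>k\<in>F. a k *\<^sub>R x k) + (\<Sum>k\<in>F. if k \<in> B then t *\<^sub>R x k else 0)"
          unfolding v_def sum.distrib[symmetric]
          by (intro sum.cong) (auto simp: a'_def scaleR_add_left)
        moreover have "(\<Sum>k\<in>F. if k \<in> B then t *\<^sub>R x k else 0) = (\<Sum>k\<in>B. t *\<^sub>R x k)"
          using FB by (intro sum.mono_neutral_cong_right) auto
        ultimately show ?thesis by simp
      qed
      ultimately show ?thesis by simp
    qed
  qed
qed

text \<open>A sign change is a difference of two suppressions, which costs a factor \<open>2\<close>; multipliers follow
  by convexity, and infinite expansions by truncation.\<close>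

lemma unconditional:
  obtains K where "unconditional_system X N x coeff K"
proof -
  obtain C where C: "1 \<le> C"
    "\<And>F A a. finite F \<Longrightarrow> A \<subseteq> F \<Longrightarrow>
      N (\<Sum>k\<in>A. a k *\<^sub>R x k) \<le> C * N (\<Sum>k\<in>F. a k *\<^sub>R x k)"
    by (fact suppression_unconditional)
  have fin: "N (\<Sum>k\<in>F. (b k * a k) *\<^sub>R x k) \<le> 2 * C * N (\<Sum>k\<in>F. a k *\<^sub>R x k)"
    if F: "finite F" and b: "\<And>k. \<bar>b k\<bar> \<le> 1" for F and a b :: "nat \<Rightarrow> real"
  proof -
    have "N (0 + (\<Sum>k\<in>F. b k *\<^sub>R (a k *\<^sub>R x k))) \<le> 2 * C * N (\<Sum>k\<in>F. a k *\<^sub>R x k)"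
    proof (rule multiplier_bound_from_signs[OF F])
      fix \<epsilon> :: "nat \<Rightarrow> real" assume \<epsilon>: "\<And>k. \<bar>\<epsilon> k\<bar> = 1"
      define A where "A = {k \<in> F. \<epsilon> k = 1}"
      have "\<epsilon> k = -1" if "k \<in> F - A" for k
        using \<epsilon>[of k] that by (auto simp: A_def abs_if split: if_splits)
      then have "(\<Sum>k\<in>F - A. \<epsilon> k *\<^sub>R (a k *\<^sub>R x k)) = (\<Sum>k\<in>F - A. - (a k *\<^sub>R x k))"
        by (intro sum.cong) auto
      moreover have "(\<Sum>k\<in>A. \<epsilon> k *\<^sub>R (a k *\<^sub>R x k)) = (\<Sum>k\<in>A. a k *\<^sub>R x k)"
        by (intro sum.cong) (auto simp: A_def)
      moreover have "A \<subseteq> F" by (auto simp: A_def)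
      ultimately have "(\<Sum>k\<in>F. \<epsilon> k *\<^sub>R (a k *\<^sub>R x k)) =
          (\<Sum>k\<in>A. a k *\<^sub>R x k) - (\<Sum>k\<in>F - A. a k *\<^sub>R x k)"
        using sum.subset_diff[of A F "\<lambda>k. \<epsilon> k *\<^sub>R (a k *\<^sub>R x k)"] F by (simp add: sum_negf)
      moreover have "N ((\<Sum>k\<in>A. a k *\<^sub>R x k) - (\<Sum>k\<in>F - A. a k *\<^sub>R x k))
          \<le> N (\<Sum>k\<in>A. a k *\<^sub>R x k) + N (\<Sum>k\<in>F - A. a k *\<^sub>R x k)"
        by (intro N_diff partial_sum_in)
      ultimately show "N (0 + (\<Sum>k\<in>F. \<epsilon> k *\<^sub>R (a k *\<^sub>R x k)))
          \<le> 2 * C * N (\<Sum>k\<in>F. a k *\<^sub>R x k)"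
        using C(2)[OF F \<open>A \<subseteq> F\<close>, of a] C(2)[OF F, of "F - A" a] by auto
    qed (use b basis_in in \<open>auto intro!: closed_intros\<close>)
    then show ?thesis by simp
  qed
  have "unconditional_system X N x coeff (2 * C)"
  proof unfold_locales
    fix F :: "nat set" and v and b :: "nat \<Rightarrow> real"
    assume F: "finite F" and v: "v \<in> X" and b: "\<And>k. \<bar>b k\<bar> \<le> 1"
    let ?S = "\<lambda>n. \<Sum>k<n. coeff v k *\<^sub>R x k"
    obtain m where m: "F \<subseteq> {..<m}" using finite_nat_iff_bounded[of F] F by auto
    have *: "N (\<Sum>k\<in>F. (b k * coeff v k) *\<^sub>R x k) \<le> 2 * C * (N v + N (v - ?S n))" if "m \<le> n" for n
    proof -
      define b' where "b' k = (if k \<in> F then b k else 0)" for k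
      have "(\<Sum>k\<in>F. (b k * coeff v k) *\<^sub>R x k) = (\<Sum>k<n. (b' k * coeff v k) *\<^sub>R x k)"
        using m that by (intro sum.mono_neutral_cong_left) (auto simp: b'_def)
      also have "N \<dots> \<le> 2 * C * N (?S n)" using b by (intro fin) (auto simp: b'_def)
      also have "\<dots> = 2 * C * N (v - (v - ?S n))" by simp
      also have "\<dots> \<le> 2 * C * (N v + N (v - ?S n))"
        using C(1) v basis_in by (intro mult_left_mono N_diff closed_intros) auto
      finally show ?thesis .
    qed
    have "(\<lambda>n. 2 * C * (N v + N (v - ?S n))) \<longlonglongrightarrow> 2 * C * (N v + 0)"
      by (intro tendsto_intros expansion[OF v])
    then show "N (\<Sum>k\<in>F. (b k * coeff v k) *\<^sub>R x k) \<le> 2 * C * N v"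
      using * by (intro LIMSEQ_le_const[where X="\<lambda>n. 2 * C * (N v + N (v - ?S n))"]) auto
  qed (use C basis_in coeff_add coeff_scale in auto)
  then show ?thesis by (rule that)
qed

text \<open>For disjoint sets, \<open>B\<close> is a greedy set of \<open>\<Sum>k\<in>A \<union> B. x k\<close>, since all coefficients are equal, and
  the competing approximation subtracts the part on \<open>A\<close>. A third set disjoint from both reduces the
  general case to this one.\<close>

lemma democratic:
  obtains C where "1 \<le> C"
    "\<And>A B. finite A \<Longrightarrow> finite B \<Longrightarrow> card A = card B \<Longrightarrow>
      N (\<Sum>k\<in>A. x k) \<le> C * N (\<Sum>k\<in>B. x k)"
proof -
  obtain C where C: "1 \<le> C"
    "\<And>v \<Lambda> A \<alpha>. v \<in> X \<Longrightarrow> finite \<Lambda> \<Longrightarrow> \<Lambda> \<noteq> {} \<Longrightarrow>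
      (\<And>n m. n \<in> \<Lambda> \<Longrightarrow> m \<notin> \<Lambda> \<Longrightarrow> \<bar>coeff v m\<bar> \<le> \<bar>coeff v n\<bar>) \<Longrightarrow> card A = card \<Lambda> \<Longrightarrow>
      N (v - (\<Sum>n\<in>\<Lambda>. coeff v n *\<^sub>R x n)) \<le> C * N (v - (\<Sum>n\<in>A. \<alpha> n *\<^sub>R x n))"
    by (fact greedy_estimate)
  have in_X: "(\<Sum>k\<in>A. x k) \<in> X" for A using partial_sum_in[of "\<lambda>_. 1" A] by simp
  have disj: "N (\<Sum>k\<in>A. x k) \<le> C * N (\<Sum>k\<in>B. x k)"
    if AB: "finite A" "finite B" "card A = card B" "A \<inter> B = {}" for A B
  proof (cases "B = {}")
    case True
    then show ?thesis using AB N_eq_0_iff[of 0] closed_intros(4) by simp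
  next
    case False
    define v where "v = (\<Sum>k\<in>A \<union> B. 1 *\<^sub>R x k)"
    have cv: "coeff v = (\<lambda>k. if k \<in> A \<union> B then 1 else 0)"
      unfolding v_def using AB by (intro coeff_finite_sum) auto
    have v: "v = (\<Sum>k\<in>A. x k) + (\<Sum>k\<in>B. x k)"
      unfolding v_def using AB by (simp add: sum.union_disjoint)
    have "N (v - (\<Sum>n\<in>B. coeff v n *\<^sub>R x n)) \<le> C * N (v - (\<Sum>n\<in>A. 1 *\<^sub>R x n))"
    proof (rule C(2))
      show "v \<in> X" unfolding v by (intro closed_intros in_X)
    qed (use AB False in \<open>auto simp: cv\<close>)
    moreover have "(\<Sum>n\<in>B. coeff v n *\<^sub>R x n) = (\<Sum>n\<in>B. x n)"
      by (intro sum.cong) (auto simp: cv)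
    ultimately show ?thesis by (simp add: v)
  qed
  show ?thesis
  proof (rule that[of "C * C"])
    show "1 \<le> C * C" using C(1) mult_mono[of 1 C 1 C] by simp
    fix A B :: "nat set" assume AB: "finite A" "finite B" "card A = card B"
    have "infinite (UNIV - (A \<union> B))" using AB by simp
    then obtain D where D: "D \<subseteq> UNIV - (A \<union> B)" "card D = card B" "finite D"
      using infinite_arbitrarily_large by metis
    have "N (\<Sum>k\<in>A. x k) \<le> C * N (\<Sum>k\<in>D. x k)" using AB D by (intro disj) auto
    also have "\<dots> \<le> C * (C * N (\<Sum>k\<in>B. x k))"
      using AB D C(1) by (intro mult_left_mono disj) auto
    finally show "N (\<Sum>k\<in>A. x k) \<le> C * C * N (\<Sum>k\<in>B. x k)" by simp
  qed
qed

end

section \<open>Weak \<open>\<ell>\<^sub>p\<close> and its separable part\<close>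

lemma sum_fun_apply: "(\<Sum>k\<in>F. g k) n = (\<Sum>k\<in>F. g k n :: real)"
  by (induction F rule: infinite_finite_induct) auto

lemma weak_lp_norm_nonneg:
  assumes "1 < p" "a \<in> weak_lp p"
  shows "0 \<le> weak_lp_norm p a"
  using abs_le_weak_lp_norm[OF assms, of 0] by linarith

text \<open>\<open>a\<close> is dominated by a rearrangement of \<open>b\<close>, so each average of \<open>a\<close> is at most the average
  of \<open>b\<close> over a set that is not larger; the weight \<open>card A powr (1 / p - 1)\<close> decreases.\<close>

lemma avg_weight_rearrangement:
  assumes p: "1 < p" and inj: "inj_on \<pi> {n. a n \<noteq> 0}" and ab: "\<And>n. \<bar>a n\<bar> \<le> \<bar>b (\<pi> n)\<bar>"
    and A: "finite A" and m: "\<And>B. finite B \<Longrightarrow> B \<noteq> {} \<Longrightarrow> card B \<le> card A \<Longrightarrow> avg_weight p b B \<le> m"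
    and "0 \<le> m"
  shows "avg_weight p a A \<le> m"
proof -
  define S where "S = {n \<in> A. a n \<noteq> 0}"
  have S: "finite S" "S \<subseteq> A" "inj_on \<pi> S"
    using A inj by (auto simp: S_def inj_on_def)
  have sum_S: "(\<Sum>k\<in>A. \<bar>a k\<bar>) = (\<Sum>k\<in>S. \<bar>a k\<bar>)"
    using A by (intro sum.mono_neutral_right) (auto simp: S_def)
  show ?thesis
  proof (cases "S = {}")
    case True
    then show ?thesis using sum_S \<open>0 \<le> m\<close> by (simp add: avg_weight_def)
  next
    case False
    have card: "card (\<pi> ` S) = card S" "0 < card S" "card S \<le> card A"
      using S A False by (auto simp: card_image card_gt_0_iff card_mono)
    have "(\<Sum>k\<in>S. \<bar>a k\<bar>) \<le> (\<Sum>k\<in>\<pi> ` S. \<bar>b k\<bar>)"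
      using S(3) by (simp add: sum.reindex sum_mono ab)
    moreover have "real (card A) powr (1 / p - 1) \<le> real (card (\<pi> ` S)) powr (1 / p - 1)"
      using card p by (intro powr_mono2') auto
    ultimately have "avg_weight p a A \<le> avg_weight p b (\<pi> ` S)"
      unfolding avg_weight_def sum_S by (intro mult_mono) (auto intro: sum_nonneg)
    also have "\<dots> \<le> m" using S card False by (intro m) auto
    finally show ?thesis .
  qed
qed

lemma weak_lp_norm_rearrangement:
  assumes "1 < p" "b \<in> weak_lp p" "inj_on \<pi> {n. a n \<noteq> 0}" "\<And>n. \<bar>a n\<bar> \<le> \<bar>b (\<pi> n)\<bar>"
  shows "weak_lp_norm p a \<le> weak_lp_norm p b"
proof (rule weak_lp_norm_le)
  fix A :: "nat set" assume "finite A"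
  then show "avg_weight p a A \<le> weak_lp_norm p b"
    by (rule avg_weight_rearrangement[OF assms(1,3,4) _ avg_weight_le_norm[OF assms(1,2)]
          weak_lp_norm_nonneg[OF assms(1,2)]])
qed

lemma weak_lp_norm_mono:
  assumes "1 < p" "b \<in> weak_lp p" "\<And>n. \<bar>a n\<bar> \<le> \<bar>b n\<bar>"
  shows "weak_lp_norm p a \<le> weak_lp_norm p b"
  by (rule weak_lp_norm_rearrangement[OF assms(1,2) _ assms(3)]) simp

lemma weak_lp_solid:
  assumes "1 < p" "b \<in> weak_lp p" "\<And>n. \<bar>a n\<bar> \<le> \<bar>b n\<bar>"
  shows "a \<in> weak_lp p"
proof (rule weak_lp_I[OF assms(1)])
  have "b \<longlonglongrightarrow> 0" using assms(2) by (simp add: weak_lp_def)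
  then show "a \<longlonglongrightarrow> 0"
    by (rule Lim_null_comparison[rotated, OF tendsto_rabs_zero]) (simp add: assms(3))
  fix A :: "nat set" assume "finite A"
  then show "avg_weight p a A \<le> weak_lp_norm p b"
    by (rule avg_weight_rearrangement[OF assms(1) inj_on_id2 assms(3) _ avg_weight_le_norm[OF assms(1,2)]
          weak_lp_norm_nonneg[OF assms(1,2)]])
qed

lemma weak_lp_qnorm_equiv:
  assumes p: "1 < p" and a: "a \<in> weak_lp p"
  shows "weak_lp_qnorm p a \<le> weak_lp_norm p a"
    and "weak_lp_norm p a \<le> weak_lp_qnorm p a / (1 - 1 / p)"
proof -
  have lim: "a \<longlonglongrightarrow> 0" using a by (simp add: weak_lp_def)
  have up: "decreasing_rearrangement a n * real (n + 1) powr (1 / p) \<le> weak_lp_qnorm p a" for n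
    using a unfolding weak_lp_qnorm_def weak_lp_def by (intro cSUP_upper) auto
  show "weak_lp_norm p a \<le> weak_lp_qnorm p a / (1 - 1 / p)"
    using avg_weight_upper[OF p lim up] by (intro weak_lp_norm_le) auto
  show "weak_lp_qnorm p a \<le> weak_lp_norm p a"
    unfolding weak_lp_qnorm_def
    using avg_weight_lower[OF lim avg_weight_le_norm[OF p a]] by (intro cSUP_least) auto
qed

lemma avg_weight_le_inv_powr_sum:
  assumes "1 < p" "0 < R" "R \<le> card A"
  shows "avg_weight p a A \<le> real R powr (1 / p - 1) * (\<Sum>k\<in>A. \<bar>a k\<bar>)"
  unfolding avg_weight_def using assms
  by (intro mult_right_mono powr_mono2' sum_nonneg) auto

lemma avg_weight_le_card_mult:
  assumes "1 < p" "finite A" "\<And>k. k \<in> A \<Longrightarrow> \<bar>a k\<bar> \<le> t"  "0 \<le> t"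
  shows "avg_weight p a A \<le> real (card A) * t"
proof (cases "A = {}")
  case False
  then have "1 \<le> real (card A)" using assms(2) by (simp add: Suc_leI card_gt_0_iff)
  then have "real (card A) powr (1 / p - 1) \<le> real (card A) powr 0"
    using assms(1) by (intro powr_mono) auto
  then have "real (card A) powr (1 / p - 1) \<le> 1" using \<open>1 \<le> real (card A)\<close> by simp
  then have "avg_weight p a A \<le> 1 * (real (card A) * t)"
    unfolding avg_weight_def using assms sum_bounded_above[of A "\<lambda>k. \<bar>a k\<bar>" t]
    by (intro mult_mono) (auto intro: sum_nonneg)
  then show ?thesis by simp
qed (simp add: avg_weight_def)

lemma inv_powr_small:
  assumes "1 < p" "0 < (\<eta>::real)"
  obtains R :: nat where "0 < R" "real R powr (1 / p - 1) * s \<le> \<eta>"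
proof -
  have "(\<lambda>R. real R powr (1 / p - 1)) \<longlonglongrightarrow> 0"
    using assms(1) filterlim_real_sequentially by (intro tendsto_neg_powr) auto
  then have "(\<lambda>R. real R powr (1 / p - 1) * s) \<longlonglongrightarrow> 0" by (rule tendsto_mult_left_zero)
  then have "eventually (\<lambda>R. real R powr (1 / p - 1) * s < \<eta>) sequentially"
    using assms(2) order_tendstoD(2) by blast
  then have "eventually (\<lambda>R. 0 < R \<and> real R powr (1 / p - 1) * s < \<eta>) sequentially"
    using eventually_gt_at_top[of 0] by eventually_elim auto
  then show ?thesis using that by (auto simp: eventually_sequentially intro: less_imp_le)
qed

lemma c00_weak_lp:
  assumes p: "1 < p" and b: "b \<in> c00"
  shows "b \<in> weak_lp p"
proof (rule weak_lp_I[OF p])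
  have fin: "finite {k. b k \<noteq> 0}" using b by (simp add: c00_def)
  then show "b \<longlonglongrightarrow> 0"
    by (intro tendsto_eventually) (simp add: eventually_cofinite flip: cofinite_eq_sequentially)
  fix A :: "nat set" assume A: "finite A" "A \<noteq> {}"
  have "avg_weight p b A \<le> real 1 powr (1 / p - 1) * (\<Sum>k\<in>A. \<bar>b k\<bar>)"
    using A by (intro avg_weight_le_inv_powr_sum[OF p]) (auto simp: Suc_le_eq card_gt_0_iff)
  also have "(\<Sum>k\<in>A. \<bar>b k\<bar>) = (\<Sum>k\<in>A \<inter> {k. b k \<noteq> 0}. \<bar>b k\<bar>)"
    using A by (intro sum.mono_neutral_right) auto
  also have "\<dots> \<le> (\<Sum>k | b k \<noteq> 0. \<bar>b k\<bar>)" using fin by (intro sum_mono2) auto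
  finally show "avg_weight p b A \<le> (\<Sum>k | b k \<noteq> 0. \<bar>b k\<bar>)" by simp
qed

definition vanishing_averages :: "real \<Rightarrow> (nat \<Rightarrow> real) \<Rightarrow> bool" where
  "vanishing_averages p a \<longleftrightarrow>
     (\<forall>\<eta>>0. \<exists>R. \<forall>A. finite A \<and> R \<le> card A \<longrightarrow> avg_weight p a A \<le> \<eta>)"

lemma vanishing_averagesE:
  assumes "vanishing_averages p a" "0 < \<eta>"
  obtains R where "\<And>A. finite A \<Longrightarrow> R \<le> card A \<Longrightarrow> avg_weight p a A \<le> \<eta>"
proof -
  obtain R where "\<forall>A. finite A \<and> R \<le> card A \<longrightarrow> avg_weight p a A \<le> \<eta>"
    using assms unfolding vanishing_averages_def by auto
  then show ?thesis using that[of R] by blast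
qed

lemma c00_vanishing_averages:
  assumes p: "1 < p" and b: "b \<in> c00"
  shows "vanishing_averages p b"
  unfolding vanishing_averages_def
proof (intro allI impI)
  fix \<eta> :: real assume \<eta>: "0 < \<eta>"
  let ?F = "{k. b k \<noteq> 0}"
  define s where "s = (\<Sum>k\<in>?F. \<bar>b k\<bar>)"
  have F: "finite ?F" using b by (simp add: c00_def)
  obtain R where R: "0 < R" "real R powr (1 / p - 1) * s \<le> \<eta>" using inv_powr_small[OF p \<eta>] .
  have "avg_weight p b A \<le> \<eta>" if A: "finite A" "R \<le> card A" for A
  proof -
    have "(\<Sum>k\<in>A. \<bar>b k\<bar>) = (\<Sum>k\<in>A \<inter> ?F. \<bar>b k\<bar>)"
      using A by (intro sum.mono_neutral_right) auto
    also have "\<dots> \<le> s" unfolding s_def using F by (intro sum_mono2) auto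
    finally have "real R powr (1 / p - 1) * (\<Sum>k\<in>A. \<bar>b k\<bar>) \<le> real R powr (1 / p - 1) * s"
      by (rule mult_left_mono) simp
    then show ?thesis using avg_weight_le_inv_powr_sum[OF p R(1) A(2), of b] R(2) by linarith
  qed
  then show "\<exists>R. \<forall>A. finite A \<and> R \<le> card A \<longrightarrow> avg_weight p b A \<le> \<eta>" by blast
qed

lemma vanishing_averages_add:
  assumes "vanishing_averages p a" "vanishing_averages p b" "\<And>n. \<bar>c n\<bar> \<le> \<bar>a n\<bar> + \<bar>b n\<bar>"
  shows "vanishing_averages p c"
  unfolding vanishing_averages_def
proof (intro allI impI)
  fix \<eta> :: real assume "0 < \<eta>"
  then have \<eta>: "0 < \<eta> / 2" by simp
  obtain R where R: "\<And>A. finite A \<Longrightarrow> R \<le> card A \<Longrightarrow> avg_weight p a A \<le> \<eta> / 2"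
    by (fact vanishing_averagesE[OF assms(1) \<eta>])
  obtain R' where R': "\<And>A. finite A \<Longrightarrow> R' \<le> card A \<Longrightarrow> avg_weight p b A \<le> \<eta> / 2"
    by (fact vanishing_averagesE[OF assms(2) \<eta>])
  have "avg_weight p c A \<le> \<eta>" if "finite A" "max R R' \<le> card A" for A
  proof -
    have "avg_weight p c A \<le> avg_weight p a A + avg_weight p b A"
      unfolding avg_weight_def distrib_left[symmetric] sum.distrib[symmetric]
      by (intro mult_left_mono sum_mono assms(3)) auto
    then show ?thesis using R[of A] R'[of A] that by simp
  qed
  then show "\<exists>R. \<forall>A. finite A \<and> R \<le> card A \<longrightarrow> avg_weight p c A \<le> \<eta>" by blast
qed

lemma truncation_error_small:
  assumes p: "1 < p" and a: "a \<in> weak_lp p" "vanishing_averages p a" and \<eta>: "0 < \<eta>"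
  obtains n0 where "\<And>n. n0 \<le> n \<Longrightarrow> weak_lp_norm p (\<lambda>k. if k < n then 0 else a k) \<le> \<eta>"
proof -
  obtain R where R: "\<And>A. finite A \<Longrightarrow> R \<le> card A \<Longrightarrow> avg_weight p a A \<le> \<eta>"
    by (fact vanishing_averagesE[OF a(2) \<eta>])
  define t where "t = \<eta> / real (Suc R)"
  have t: "0 < t" "real R * t \<le> \<eta>" using \<eta> by (auto simp: t_def field_simps)
  have "a \<longlonglongrightarrow> 0" using a(1) by (simp add: weak_lp_def)
  then obtain n0 where n0: "\<And>k. n0 \<le> k \<Longrightarrow> \<bar>a k\<bar> < t"
    using LIMSEQ_D[of a 0 t] t(1) by auto
  show ?thesis
  proof (rule that[of n0], rule weak_lp_norm_le)
    fix n and A :: "nat set" assume n: "n0 \<le> n" and A: "finite A" "A \<noteq> {}"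
    let ?a = "\<lambda>k. if k < n then 0 else a k"
    show "avg_weight p ?a A \<le> \<eta>"
    proof (cases "R \<le> card A")
      case True
      have "avg_weight p ?a A \<le> avg_weight p a A"
        unfolding avg_weight_def by (intro mult_left_mono sum_mono) auto
      then show ?thesis using R[OF A(1) True] by linarith
    next
      case False
      have "\<bar>?a k\<bar> \<le> t" for k using n0[of k] n t(1) by auto
      then have "avg_weight p ?a A \<le> real (card A) * t"
        using A t(1) by (intro avg_weight_le_card_mult[OF p]) auto
      also have "\<dots> \<le> real R * t" using False t(1) by (intro mult_right_mono) auto
      finally show ?thesis using t(2) by linarith
    qed
  qed
qed

text \<open>Finitely supported sequences have small averages over large sets, and this passes to limits.
  Conversely it makes the truncations converge, since averages over small sets are controlled by
  the supremum of the tail.\<close>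

lemma separable_part_iff:
  assumes p: "1 < p"
  shows "a \<in> weak_lp_separable_part p \<longleftrightarrow> a \<in> weak_lp p \<and> vanishing_averages p a"
proof (intro iffI conjI)
  assume a: "a \<in> weak_lp_separable_part p"
  then show a': "a \<in> weak_lp p" by (simp add: weak_lp_separable_part_def)
  have q: "0 < 1 - 1 / p" using p by simp
  show "vanishing_averages p a"
    unfolding vanishing_averages_def
  proof (intro allI impI)
    fix \<eta> :: real assume \<eta>: "0 < \<eta>"
    then have "0 < \<eta> / 2 * (1 - 1 / p)" using q by simp
    then obtain b where b: "b \<in> c00" "weak_lp_qnorm p (a - b) < \<eta> / 2 * (1 - 1 / p)"
      using a unfolding weak_lp_separable_part_def by blast
    obtain R where R: "\<And>A. finite A \<Longrightarrow> R \<le> card A \<Longrightarrow> avg_weight p b A \<le> \<eta> / 2"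
      by (fact vanishing_averagesE[OF c00_vanishing_averages[OF p b(1)] half_gt_zero[OF \<eta>]])
    have ab: "a - b \<in> weak_lp p"
      using a' c00_weak_lp[OF p b(1)] subspace_weak_lp[OF p] subspace_diff by blast
    have small: "weak_lp_norm p (a - b) \<le> \<eta> / 2"
    proof -
      have "weak_lp_norm p (a - b) \<le> weak_lp_qnorm p (a - b) / (1 - 1 / p)"
        by (rule weak_lp_qnorm_equiv[OF p ab])
      also have "\<dots> \<le> (\<eta> / 2 * (1 - 1 / p)) / (1 - 1 / p)"
        using b(2) q by (intro divide_right_mono) auto
      also have "\<dots> = \<eta> / 2" by (intro nonzero_mult_div_cancel_right) (use p in simp)
      finally show ?thesis .
    qed
    have "avg_weight p a A \<le> \<eta>" if A: "finite A" "Suc R \<le> card A" for A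
    proof -
      have "avg_weight p (b + (a - b)) A \<le> avg_weight p b A + avg_weight p (a - b) A"
        by (rule avg_weight_add)
      moreover have "avg_weight p (a - b) A \<le> weak_lp_norm p (a - b)"
        using A by (intro avg_weight_le_norm[OF p ab]) auto
      ultimately show ?thesis using R[of A] A small by simp
    qed
    then show "\<exists>R. \<forall>A. finite A \<and> R \<le> card A \<longrightarrow> avg_weight p a A \<le> \<eta>" by blast
  qed
next
  assume a: "a \<in> weak_lp p \<and> vanishing_averages p a"
  have "\<exists>b\<in>c00. weak_lp_qnorm p (a - b) < \<epsilon>" if \<epsilon>: "0 < \<epsilon>" for \<epsilon>
  proof -
    obtain n where n: "weak_lp_norm p (\<lambda>k. if k < n then 0 else a k) \<le> \<epsilon> / 2"
      using truncation_error_small[OF p, of a "\<epsilon> / 2"] a \<epsilon> by (metis half_gt_zero order_refl)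
    let ?b = "\<lambda>k. if k < n then a k else 0"
    have eq: "a - ?b = (\<lambda>k. if k < n then 0 else a k)" by auto
    have "a - ?b \<in> weak_lp p"
      unfolding eq by (rule weak_lp_solid[OF p conjunct1[OF a]]) simp
    then have "weak_lp_qnorm p (a - ?b) < \<epsilon>"
      using weak_lp_qnorm_equiv(1)[OF p, of "a - ?b"] n \<epsilon> unfolding eq by linarith
    moreover have "?b \<in> c00" unfolding c00_def by (auto intro: finite_subset[of _ "{..<n}"])
    ultimately show ?thesis by blast
  qed
  then show "a \<in> weak_lp_separable_part p" using a by (auto simp: weak_lp_separable_part_def)
qed

lemma avg_weight_abs_add:
  "avg_weight p (\<lambda>n. \<bar>a n\<bar> + \<bar>b n\<bar>) A = avg_weight p a A + avg_weight p b A"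
  by (simp add: avg_weight_def sum.distrib distrib_left)

text \<open>Adding to \<open>s\<close> a vector with small entries costs no more than the larger of the two norms:
  averages over small sets do not see \<open>y\<close>, and averages over large sets do not see \<open>s\<close>.\<close>

lemma norm_add_small_entries:
  assumes p: "1 < p" and s: "s \<in> weak_lp p" "vanishing_averages p s" and \<eta>: "0 < \<eta>"
  obtains \<epsilon> where "0 < \<epsilon>"
    "\<And>y. y \<in> weak_lp p \<Longrightarrow> weak_lp_norm p y \<le> M \<Longrightarrow> (\<And>n. \<bar>y n\<bar> \<le> \<epsilon>) \<Longrightarrow>
      weak_lp_norm p (\<lambda>n. \<bar>s n\<bar> + \<bar>y n\<bar>) \<le> max (weak_lp_norm p s) M + \<eta>"
proof -
  obtain R where R: "\<And>A. finite A \<Longrightarrow> R \<le> card A \<Longrightarrow> avg_weight p s A \<le> \<eta>"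
    by (fact vanishing_averagesE[OF s(2) \<eta>])
  define \<epsilon> where "\<epsilon> = \<eta> / real (Suc R)"
  have \<epsilon>: "0 < \<epsilon>" "real R * \<epsilon> \<le> \<eta>" using \<eta> by (auto simp: \<epsilon>_def field_simps)
  show ?thesis
  proof (rule that[OF \<epsilon>(1)], rule weak_lp_norm_le)
    fix y and A :: "nat set"
    assume y: "y \<in> weak_lp p" "weak_lp_norm p y \<le> M" "\<And>n. \<bar>y n\<bar> \<le> \<epsilon>" and A: "finite A" "A \<noteq> {}"
    show "avg_weight p (\<lambda>n. \<bar>s n\<bar> + \<bar>y n\<bar>) A \<le> max (weak_lp_norm p s) M + \<eta>"
    proof (cases "R \<le> card A")
      case True
      then show ?thesis
        using R[of A] A avg_weight_le_norm[OF p y(1) A] y(2) by (simp add: avg_weight_abs_add)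
    next
      case False
      have "avg_weight p y A \<le> real (card A) * \<epsilon>"
        using A y(3) \<epsilon>(1) by (intro avg_weight_le_card_mult[OF p]) auto
      also have "\<dots> \<le> real R * \<epsilon>" using False \<epsilon>(1) by (intro mult_right_mono) auto
      finally show ?thesis
        using \<epsilon>(2) avg_weight_le_norm[OF p s(1) A] by (simp add: avg_weight_abs_add)
    qed
  qed
qed

text \<open>Averages over small sets see only the bound \<open>\<epsilon>\<close>, averages over large sets only the
  dominating \<open>s\<close>. Thus the parts of \<open>s\<close> with entries at most \<open>\<epsilon>\<close> tend to \<open>0\<close> in norm with \<open>\<epsilon>\<close>.\<close>

lemma norm_dominated_small_entries:
  assumes p: "1 < p" and s: "vanishing_averages p s" and \<eta>: "0 < \<eta>"
  obtains \<epsilon> where "0 < \<epsilon>"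
    "\<And>y. (\<And>n. \<bar>y n\<bar> \<le> \<bar>s n\<bar>) \<Longrightarrow> (\<And>n. \<bar>y n\<bar> \<le> \<epsilon>) \<Longrightarrow> weak_lp_norm p y \<le> \<eta>"
proof -
  obtain R where R: "\<And>A. finite A \<Longrightarrow> R \<le> card A \<Longrightarrow> avg_weight p s A \<le> \<eta>"
    by (fact vanishing_averagesE[OF s \<eta>])
  define \<epsilon> where "\<epsilon> = \<eta> / real (Suc R)"
  have \<epsilon>: "0 < \<epsilon>" "real R * \<epsilon> \<le> \<eta>" using \<eta> by (auto simp: \<epsilon>_def field_simps)
  show ?thesis
  proof (rule that[OF \<epsilon>(1)], rule weak_lp_norm_le)
    fix y :: "nat \<Rightarrow> real" and A :: "nat set"
    assume y: "\<And>n. \<bar>y n\<bar> \<le> \<bar>s n\<bar>" "\<And>n. \<bar>y n\<bar> \<le> \<epsilon>" and A: "finite A" "A \<noteq> {}"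
    show "avg_weight p y A \<le> \<eta>"
    proof (cases "R \<le> card A")
      case True
      have "avg_weight p y A \<le> avg_weight p s A"
        unfolding avg_weight_def using y(1) by (intro mult_left_mono sum_mono) auto
      then show ?thesis using R[OF A(1) True] by linarith
    next
      case False
      have "avg_weight p y A \<le> real (card A) * \<epsilon>"
        using A y(2) \<epsilon>(1) by (intro avg_weight_le_card_mult[OF p]) auto
      also have "\<dots> \<le> real R * \<epsilon>" using False \<epsilon>(1) by (intro mult_right_mono) auto
      finally show ?thesis using \<epsilon>(2) by linarith
    qed
  qed
qed

lemma card_powr_le_norm:
  assumes p: "1 < p" and a: "a \<in> weak_lp p" and F: "finite F" and t: "\<And>n. n \<in> F \<Longrightarrow> t \<le> \<bar>a n\<bar>"
  shows "real (card F) powr (1 / p) * t \<le> weak_lp_norm p a"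
proof (cases "F = {}")
  case True
  then show ?thesis using weak_lp_norm_nonneg[OF p a] by simp
next
  case False
  have "real (card F) powr (1 / p) * t = real (card F) powr (1 / p - 1) * (real (card F) * t)"
    using F False by (simp add: powr_diff)
  also have "\<dots> \<le> avg_weight p a F"
    unfolding avg_weight_def using t sum_bounded_below[of F t "\<lambda>k. \<bar>a k\<bar>"]
    by (intro mult_left_mono) auto
  also have "\<dots> \<le> weak_lp_norm p a" by (rule avg_weight_le_norm[OF p a F False])
  finally show ?thesis .
qed

lemma norm_le_card_powr:
  assumes p: "1 < p" and F: "finite F" and a: "\<And>n. n \<notin> F \<Longrightarrow> a n = 0" "\<And>n. \<bar>a n\<bar> \<le> 1"
  shows "weak_lp_norm p a \<le> real (card F) powr (1 / p)"
proof (rule weak_lp_norm_le)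
  fix A :: "nat set" assume A: "finite A" "A \<noteq> {}"
  show "avg_weight p a A \<le> real (card F) powr (1 / p)"
  proof (cases "A \<inter> F = {}")
    case True
    then have "(\<Sum>k\<in>A. \<bar>a k\<bar>) = 0" using a(1) by (intro sum.neutral) auto
    then show ?thesis by (simp add: avg_weight_def)
  next
    case False
    let ?B = "A \<inter> F"
    have B: "0 < card ?B" "card ?B \<le> card A" "card ?B \<le> card F"
      using False F A by (auto simp: card_gt_0_iff intro: card_mono)
    have "(\<Sum>k\<in>A. \<bar>a k\<bar>) = (\<Sum>k\<in>?B. \<bar>a k\<bar>)"
      using A a(1) by (intro sum.mono_neutral_right) auto
    also have "\<dots> \<le> real (card ?B)" using sum_bounded_above[of ?B "\<lambda>k. \<bar>a k\<bar>" 1] a(2) by simp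
    finally have "avg_weight p a A \<le> real (card ?B) powr (1 / p - 1) * real (card ?B)"
      unfolding avg_weight_def using B p
      by (intro mult_mono powr_mono2') (auto intro: sum_nonneg)
    also have "\<dots> = real (card ?B) powr (1 / p)" using B by (simp add: powr_diff)
    also have "\<dots> \<le> real (card F) powr (1 / p)" using B p by (intro powr_mono2) auto
    finally show ?thesis .
  qed
qed

section \<open>The unit vector basis\<close>

definition unit_seq :: "nat \<Rightarrow> nat \<Rightarrow> real" where
  "unit_seq k = (\<lambda>n. if n = k then 1 else 0)"

lemma sum_unit_seq: "finite F \<Longrightarrow>
    (\<Sum>k\<in>F. a k *\<^sub>R unit_seq k) = (\<lambda>n. if n \<in> F then a n else 0)"
proof (rule ext)
  fix n assume F: "finite F"
  have "(\<Sum>k\<in>F. a k *\<^sub>R unit_seq k) n = (\<Sum>k\<in>F. if k = n then a k else 0)"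
    unfolding sum_fun_apply by (intro sum.cong) (auto simp: unit_seq_def scaleR_fun_def)
  then show "(\<Sum>k\<in>F. a k *\<^sub>R unit_seq k) n = (if n \<in> F then a n else 0)"
    using F by simp
qed

text \<open>The given norm is arbitrary within its equivalence class, so that estimates are made for the
  rearrangement invariant \<open>weak_lp_norm\<close> and transferred at the cost of factors \<open>D\<close>.\<close>

locale renormed_weak_lp =
  fixes p :: real and N :: "(nat \<Rightarrow> real) \<Rightarrow> real" and D :: real
  assumes p: "1 < p"
    and norm_on_weak_lp_N: "norm_on (weak_lp p) N"
    and D: "1 \<le> D"
    and N_le: "a \<in> weak_lp p \<Longrightarrow> N a \<le> D * weak_lp_norm p a"
    and norm_le: "a \<in> weak_lp p \<Longrightarrow> weak_lp_norm p a \<le> D * N a"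
begin

abbreviation X :: "(nat \<Rightarrow> real) set" where "X \<equiv> weak_lp_separable_part p"
abbreviation W :: "(nat \<Rightarrow> real) \<Rightarrow> real" where "W \<equiv> weak_lp_norm p"

lemma in_weak_lp: "a \<in> X \<Longrightarrow> a \<in> weak_lp p"
  and in_vanishing: "a \<in> X \<Longrightarrow> vanishing_averages p a"
  by (simp_all add: separable_part_iff[OF p])

lemma c00_in: "a \<in> c00 \<Longrightarrow> a \<in> X"
  by (simp add: separable_part_iff[OF p] c00_weak_lp[OF p] c00_vanishing_averages[OF p])

lemma add_in:
  assumes "a \<in> X" "b \<in> X"
  shows "a + b \<in> X"
proof -
  have "vanishing_averages p (a + b)"
    by (rule vanishing_averages_add[OF assms[THEN in_vanishing]]) (simp add: abs_triangle_ineq)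
  then show ?thesis
    using weak_lp_add(1)[OF p assms[THEN in_weak_lp]] by (simp add: separable_part_iff[OF p])
qed

lemma solid:
  assumes "b \<in> X" "\<And>n. \<bar>a n\<bar> \<le> \<bar>b n\<bar>"
  shows "a \<in> X"
proof -
  have "0 \<in> X" by (intro c00_in) (simp add: c00_def)
  then have "vanishing_averages p a"
    using vanishing_averages_add[OF in_vanishing[OF assms(1)] in_vanishing, of 0 a] assms(2)
    by simp
  then show ?thesis
    using weak_lp_solid[OF p in_weak_lp[OF assms(1)] assms(2)] by (simp add: separable_part_iff[OF p])
qed

lemma scale_in:
  assumes "a \<in> X"
  shows "c *\<^sub>R a \<in> X"
proof -
  have "vanishing_averages p (c *\<^sub>R a)"
    unfolding vanishing_averages_def avg_weight_scale
  proof (intro allI impI)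
    fix \<eta> :: real assume \<eta>: "0 < \<eta>"
    have \<eta>': "0 < \<eta> / (\<bar>c\<bar> + 1)" using \<eta> by (intro divide_pos_pos) auto
    obtain R where R: "\<And>A. finite A \<Longrightarrow> R \<le> card A \<Longrightarrow> avg_weight p a A \<le> \<eta> / (\<bar>c\<bar> + 1)"
      by (fact vanishing_averagesE[OF in_vanishing[OF assms] \<eta>'])
    have "\<bar>c\<bar> * avg_weight p a A \<le> \<eta>" if "finite A" "R \<le> card A" for A
    proof -
      have "\<bar>c\<bar> * avg_weight p a A \<le> \<bar>c\<bar> * (\<eta> / (\<bar>c\<bar> + 1))"
        using R that by (intro mult_left_mono) auto
      also have "\<dots> \<le> \<eta>" using \<eta> by (simp add: field_simps)
      finally show ?thesis .
    qed
    then show "\<exists>R. \<forall>A. finite A \<and> R \<le> card A \<longrightarrow> \<bar>c\<bar> * avg_weight p a A \<le> \<eta>" by blast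
  qed
  then show ?thesis
    using weak_lp_scale(1)[OF p in_weak_lp[OF assms]] by (simp add: separable_part_iff[OF p])
qed

sublocale normed_subspace X N
proof
  have "subspace X" by (rule subspaceI) (auto intro: add_in scale_in c00_in simp: c00_def)
  then show "norm_on X N"
    using norm_on_weak_lp_N in_weak_lp by (simp add: norm_on_def)
qed

lemma W_mono: "b \<in> X \<Longrightarrow> (\<And>n. \<bar>a n\<bar> \<le> \<bar>b n\<bar>) \<Longrightarrow> W a \<le> W b"
  by (rule weak_lp_norm_mono[OF p in_weak_lp])

lemma W_nonneg: "a \<in> X \<Longrightarrow> 0 \<le> W a"
  by (rule weak_lp_norm_nonneg[OF p in_weak_lp])

lemma N_le_W: "a \<in> X \<Longrightarrow> N a \<le> D * W a"
  and W_le_N: "a \<in> X \<Longrightarrow> W a \<le> D * N a"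
  using N_le norm_le in_weak_lp by auto

lemma unit_seq_in: "unit_seq k \<in> X"
  by (intro c00_in) (simp add: c00_def unit_seq_def)

lemma N_unit_seq_le: "N (unit_seq k) \<le> D"
proof -
  have "W (unit_seq k) \<le> real (card {k}) powr (1 / p)"
    by (intro norm_le_card_powr[OF p]) (auto simp: unit_seq_def)
  then have "D * W (unit_seq k) \<le> D * 1" using D by (intro mult_left_mono) auto
  then show ?thesis using N_le_W[OF unit_seq_in, of k] by simp
qed

lemma unit_seq_unconditional: "unconditional_system X N unit_seq (\<lambda>v. v) (D * D)"
proof unfold_locales
  show "1 \<le> D * D" using D mult_mono[of 1 D 1 D] by simp
  fix F :: "nat set" and v and b :: "nat \<Rightarrow> real" assume F: "finite F" and v: "v \<in> X" and b: "\<And>k. \<bar>b k\<bar> \<le> 1"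
  let ?u = "\<Sum>k\<in>F. (b k * v k) *\<^sub>R unit_seq k"
  have le: "\<bar>?u n\<bar> \<le> \<bar>v n\<bar>" for n
    using b[of n] mult_right_mono[of "\<bar>b n\<bar>" 1 "\<bar>v n\<bar>"]
    by (simp add: sum_unit_seq[OF F] abs_mult)
  have "N ?u \<le> D * W ?u" by (rule N_le_W[OF solid[OF v le]])
  also have "\<dots> \<le> D * W v" using D by (intro mult_left_mono W_mono[OF v le]) auto
  also have "\<dots> \<le> D * (D * N v)" using D by (intro mult_left_mono W_le_N[OF v]) auto
  finally show "N ?u \<le> D * D * N v" by simp
qed (use unit_seq_in in \<open>auto simp: scaleR_fun_def\<close>)

sublocale unit: unconditional_system X N unit_seq "\<lambda>v. v" "D * D"
  by (rule unit_seq_unconditional)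

lemma unit_seq_expansion:
  assumes v: "v \<in> X"
  shows "(\<lambda>n. N (v - (\<Sum>k<n. v k *\<^sub>R unit_seq k))) \<longlonglongrightarrow> 0"
proof (rule LIMSEQ_I)
  fix r :: real assume "0 < r"
  then have "0 < r / (2 * D)" using D by simp
  then obtain n0 where n0: "\<And>n. n0 \<le> n \<Longrightarrow> W (\<lambda>k. if k < n then 0 else v k) \<le> r / (2 * D)"
    using truncation_error_small[OF p in_weak_lp[OF v] in_vanishing[OF v]] by metis
  have "norm (N (v - (\<Sum>k<n. v k *\<^sub>R unit_seq k)) - 0) < r" if "n0 \<le> n" for n
  proof -
    let ?r = "v - (\<Sum>k<n. v k *\<^sub>R unit_seq k)"
    have eq: "?r = (\<lambda>k. if k < n then 0 else v k)" by (auto simp: sum_unit_seq)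
    have r: "?r \<in> X" using v unit_seq_in by (intro closed_intros)
    have "N ?r \<le> D * W ?r" by (rule N_le_W[OF r])
    also have "\<dots> \<le> D * (r / (2 * D))"
      unfolding eq using D n0[OF that] by (intro mult_left_mono) auto
    also have "\<dots> = r / 2" using D by simp
    finally show ?thesis using N_nonneg[OF r] \<open>0 < r\<close> by simp
  qed
  then show "\<exists>no. \<forall>n\<ge>no. norm (N (v - (\<Sum>k<n. v k *\<^sub>R unit_seq k)) - 0) < r" by blast
qed

lemma unit_seq_expansion_unique:
  assumes v: "v \<in> X" and a: "(\<lambda>n. N (v - (\<Sum>k<n. a k *\<^sub>R unit_seq k))) \<longlonglongrightarrow> 0"
  shows "a = v"
proof
  fix j
  have "\<bar>v j - a j\<bar> \<le> D * N (v - (\<Sum>k<n. a k *\<^sub>R unit_seq k))" if "Suc j \<le> n" for n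
  proof -
    let ?r = "v - (\<Sum>k<n. a k *\<^sub>R unit_seq k)"
    have r: "?r \<in> X" using v unit_seq_in by (intro closed_intros)
    have "?r j = v j - a j" using that by (simp add: sum_unit_seq)
    then show ?thesis using abs_le_weak_lp_norm[OF p in_weak_lp[OF r], of j] W_le_N[OF r] by simp
  qed
  moreover have "(\<lambda>n. D * N (v - (\<Sum>k<n. a k *\<^sub>R unit_seq k))) \<longlonglongrightarrow> 0"
    using tendsto_mult_right_zero[OF a] by simp
  ultimately have "\<bar>v j - a j\<bar> \<le> 0" by (meson LIMSEQ_le_const)
  then show "a j = v j" by simp
qed

lemma schauder_basis_unit_seq: "schauder_basis X N unit_seq"
  unfolding schauder_basis_def
proof (intro conjI ballI ex1I)
  show "range unit_seq \<subseteq> X" using unit_seq_in by auto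
qed (use unit_seq_expansion unit_seq_expansion_unique in auto)

lemma basis_coeff_unit_seq: "v \<in> X \<Longrightarrow> basis_coeff N unit_seq v = v"
  unfolding basis_coeff_def
  by (rule the_equality) (use unit_seq_expansion unit_seq_expansion_unique in auto)

text \<open>Let \<open>w\<close> be the error of a competing approximation supported on \<open>A\<close>. Outside
  \<open>A \<union> \<Lambda>\<close> the greedy error agrees with \<open>w\<close>; on \<open>A - \<Lambda>\<close> it is dominated by the entries of \<open>w\<close>
  on the equally large set \<open>\<Lambda> - A\<close>, because \<open>\<Lambda>\<close> carries the largest entries of \<open>v\<close>.\<close>

lemma unit_seq_greedy_estimate:
  assumes v: "v \<in> X" and L: "finite \<Lambda>" "\<Lambda> \<noteq> {}" "\<And>n m. n \<in> \<Lambda> \<Longrightarrow> m \<notin> \<Lambda> \<Longrightarrow> \<bar>v m\<bar> \<le> \<bar>v n\<bar>"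
    and A: "card A = card \<Lambda>"
  shows "N (v - (\<Sum>n\<in>\<Lambda>. v n *\<^sub>R unit_seq n))
    \<le> 2 * D * D * N (v - (\<Sum>n\<in>A. \<alpha> n *\<^sub>R unit_seq n))"
proof -
  let ?r = "v - (\<Sum>n\<in>\<Lambda>. v n *\<^sub>R unit_seq n)" and ?w = "v - (\<Sum>n\<in>A. \<alpha> n *\<^sub>R unit_seq n)"
  have "finite A" using A L by (metis card_eq_0_iff)
  have w: "?w \<in> X" and r: "?r \<in> X" using v unit_seq_in by (auto intro!: closed_intros)
  have w_off: "?w n = v n" if "n \<notin> A" for n using that \<open>finite A\<close> by (simp add: sum_unit_seq)
  have "card (A - \<Lambda>) = card (\<Lambda> - A)"
    using A L(1) \<open>finite A\<close> by (simp add: card_Diff_subset_Int Int_commute)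
  then obtain g where g: "bij_betw g (A - \<Lambda>) (\<Lambda> - A)"
    using finite_same_card_bij[of "A - \<Lambda>" "\<Lambda> - A"] L(1) \<open>finite A\<close> by auto
  define r1 where "r1 n = (if n \<in> \<Lambda> \<union> A then 0 else v n)" for n
  define r2 where "r2 n = (if n \<in> A - \<Lambda> then v n else 0)" for n
  have r_eq: "?r = r1 + r2" using L(1) by (auto simp: r1_def r2_def sum_unit_seq)
  have r1_le: "\<bar>r1 n\<bar> \<le> \<bar>?w n\<bar>" for n using w_off[of n] by (simp add: r1_def)
  have "\<bar>r2 n\<bar> \<le> \<bar>?w (g n)\<bar>" for n
  proof (cases "n \<in> A - \<Lambda>")
    case True
    then have "g n \<in> \<Lambda> - A" using g by (auto simp: bij_betw_def)
    then show ?thesis using True L(3)[of "g n" n] w_off[of "g n"] by (simp add: r2_def)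
  qed (auto simp: r2_def)
  moreover have "inj_on g {n. r2 n \<noteq> 0}"
    using g by (auto simp: bij_betw_def r2_def intro: inj_on_subset)
  ultimately have W2: "W r2 \<le> W ?w"
    by (intro weak_lp_norm_rearrangement[OF p in_weak_lp[OF w]])
  have W1: "W r1 \<le> W ?w" by (rule W_mono[OF w r1_le])
  have "r1 \<in> X" by (rule solid[OF v]) (simp add: r1_def)
  moreover have "r2 \<in> X" by (rule solid[OF v]) (simp add: r2_def)
  ultimately have "W ?r \<le> W r1 + W r2" unfolding r_eq by (intro weak_lp_add(2)[OF p] in_weak_lp)
  then have "W ?r \<le> 2 * W ?w" using W1 W2 by linarith
  also have "\<dots> \<le> 2 * (D * N ?w)" using W_le_N[OF w] by linarith
  finally have "D * W ?r \<le> D * (2 * (D * N ?w))" using D by (intro mult_left_mono) auto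
  then show ?thesis using N_le_W[OF r] by (simp add: mult_ac)
qed

lemma greedy_basis_unit_seq: "greedy_basis X N unit_seq"
  unfolding greedy_basis_def
proof (intro conjI exI ballI allI impI)
  show "schauder_basis X N unit_seq" by (rule schauder_basis_unit_seq)
  have "1 / D \<le> N (unit_seq k)" for k
  proof -
    have "1 \<le> W (unit_seq k)"
      using abs_le_weak_lp_norm[OF p in_weak_lp[OF unit_seq_in], of k k] by (simp add: unit_seq_def)
    then show ?thesis using W_le_N[OF unit_seq_in, of k] D by (simp add: field_simps)
  qed
  then have "1 / D \<le> (INF n. N (unit_seq n))" by (intro cINF_greatest) auto
  moreover have "0 < 1 / D" using D by simp
  ultimately have "0 < (INF n. N (unit_seq n))" by linarith
  then show "semi_normalized N unit_seq"
    unfolding semi_normalized_def by (intro conjI bdd_aboveI2[OF N_unit_seq_le])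
next
  fix v \<Lambda>
  assume v: "v \<in> X" and L: "finite \<Lambda> \<and> \<Lambda> \<noteq> {} \<and> (\<forall>n\<in>\<Lambda>. \<forall>m. m \<notin> \<Lambda> \<longrightarrow>
      \<bar>basis_coeff N unit_seq v m\<bar> \<le> \<bar>basis_coeff N unit_seq v n\<bar>)"
  let ?S = "{N (v - (\<Sum>n\<in>A. \<alpha> n *\<^sub>R unit_seq n)) | A \<alpha>. card A = card \<Lambda>}"
  let ?r = "N (v - (\<Sum>n\<in>\<Lambda>. v n *\<^sub>R unit_seq n))"
  have DD: "0 < 2 * D * D" using D by simp
  have "?r / (2 * D * D) \<le> t" if t_in: "t \<in> ?S" for t
  proof -
    obtain A \<alpha> where t: "t = N (v - (\<Sum>n\<in>A. \<alpha> n *\<^sub>R unit_seq n))" "card A = card \<Lambda>"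
      using t_in by auto
    have "?r \<le> 2 * D * D * t"
      unfolding t(1) using L by (intro unit_seq_greedy_estimate[OF v _ _ _ t(2)])
        (auto simp: basis_coeff_unit_seq[OF v])
    then show ?thesis using DD by (simp add: divide_le_eq mult_ac)
  qed
  then have "?r / (2 * D * D) \<le> Inf ?S" by (intro cInf_greatest) auto
  then show "N (v - (\<Sum>n\<in>\<Lambda>. basis_coeff N unit_seq v n *\<^sub>R unit_seq n)) \<le> (2 * D * D) * Inf ?S"
    unfolding basis_coeff_unit_seq[OF v] using DD by (simp add: divide_le_eq mult_ac)
qed

end

section \<open>Greedy bases of the separable part\<close>

locale greedy_basis_of_weak_lp =
  renormed_weak_lp p N D + normed_greedy_basis "weak_lp_separable_part p" N x
  for p N D x +
  fixes K c R :: real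
  assumes unconditional_K:
      "unconditional_system (weak_lp_separable_part p) N x (basis_coeff N x) K"
    and c: "0 < c" "c \<le> N (x k)"
    and R: "N (x k) \<le> R"
begin

sublocale unconditional_system X N x coeff K
  by (rule unconditional_K)

lemma abs_coeff_le: "v \<in> X \<Longrightarrow> \<bar>coeff v k\<bar> \<le> K / c * N v"
proof -
  assume v: "v \<in> X"
  have "\<bar>coeff v k\<bar> * c \<le> \<bar>coeff v k\<bar> * N (x k)" by (intro mult_left_mono c) auto
  also have "\<dots> \<le> K * N v" by (rule coefficient_bound[OF v])
  finally show ?thesis using c by (simp add: field_simps)
qed

lemma coeff_sum_unit_seq: "coeff (\<Sum>n\<in>F. a n *\<^sub>R unit_seq n) k = (\<Sum>n\<in>F. a n * coeff (unit_seq n) k)"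
  using unit_seq_in by (simp add: f_sum f_scale closed_intros)

text \<open>Testing the \<open>k\<close>-th functional on signed sums of \<open>m\<close> unit vectors, whose norm is of the
  order \<open>m powr (1 / p)\<close>, which is less than linear, shows that it is small on most unit vectors.\<close>

lemma coeff_unit_seq_finite:
  assumes \<eta>: "0 < \<eta>"
  shows "finite {n. \<eta> < \<bar>coeff (unit_seq n) k\<bar>}"
proof (rule ccontr)
  assume inf: "infinite {n. \<eta> < \<bar>coeff (unit_seq n) k\<bar>}"
  obtain m :: nat where m: "0 < m" "real m powr (1 / p - 1) * (K / c * D) \<le> \<eta> / 2"
    using inv_powr_small[OF p half_gt_zero[OF \<eta>]] by metis
  obtain F where F: "finite F" "card F = m" "F \<subseteq> {n. \<eta> < \<bar>coeff (unit_seq n) k\<bar>}"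
    using infinite_arbitrarily_large[OF inf] by metis
  define u where "u = (\<Sum>n\<in>F. sgn (coeff (unit_seq n) k) *\<^sub>R unit_seq n)"
  have u: "u \<in> X" unfolding u_def by (rule unit.span_in)
  have "real m * \<eta> \<le> (\<Sum>n\<in>F. \<bar>coeff (unit_seq n) k\<bar>)"
    using sum_bounded_below[of F \<eta> "\<lambda>n. \<bar>coeff (unit_seq n) k\<bar>"] F by (auto simp: less_imp_le subset_eq)
  also have "\<dots> = coeff u k"
    unfolding u_def coeff_sum_unit_seq by (simp add: sgn_mult_self_eq abs_sgn mult.commute)
  also have "\<dots> \<le> K / c * N u" using abs_coeff_le[OF u, of k] by simp
  also have "\<dots> \<le> K / c * (D * W u)" using K_ge_1 c by (intro mult_left_mono N_le_W[OF u]) auto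
  also have "\<dots> \<le> K / c * (D * real m powr (1 / p))"
  proof -
    have "W u \<le> real (card F) powr (1 / p)"
      using F(1) by (intro norm_le_card_powr[OF p F(1)]) (auto simp: u_def sum_unit_seq abs_sgn_eq)
    then show ?thesis using K_ge_1 c D F(2) by (intro mult_left_mono) auto
  qed
  also have "\<dots> = real m * (real m powr (1 / p - 1) * (K / c * D))"
    using m by (simp add: powr_diff field_simps)
  also have "\<dots> \<le> real m * (\<eta> / 2)" using m by (intro mult_left_mono) auto
  finally show False using m \<eta> by simp
qed

lemma coeff_indicator_sum: "finite F \<Longrightarrow> coeff (\<Sum>k\<in>F. x k) = (\<lambda>k. if k \<in> F then 1 else 0)"
  using coeff_finite_sum[of F "\<lambda>_. 1"] by simp

lemma indicator_sum_in: "(\<Sum>k\<in>F. x k) \<in> X"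
  by (intro closed_intros basis_in)

text \<open>A vector whose coordinates are bounded by \<open>s\<close> is obtained from \<open>\<Sum>k<n. s *\<^sub>R x k\<close>, \<open>n\<close> large, by
  multipliers, up to a small error.\<close>

lemma N_le_sup_coeff:
  assumes M: "\<And>F. finite F \<Longrightarrow> N (\<Sum>k\<in>F. x k) \<le> M"
    and v: "v \<in> X" and s: "0 < s" "\<And>k. \<bar>coeff v k\<bar> \<le> s"
  shows "N v \<le> s * K * M"
proof -
  let ?S = "\<lambda>n. \<Sum>k<n. coeff v k *\<^sub>R x k"
  have S: "?S n \<in> X" for n by (rule partial_sum_in)
  have "N v \<le> N (v - ?S n) + s * K * M" for n
  proof -
    let ?u = "\<Sum>k<n. x k"
    have "N (?S n) \<le> s * K * N ?u"
      using s by (intro dominated_coefficients indicator_sum_in) (auto simp: coeff_indicator_sum)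
    also have "\<dots> \<le> s * K * M" using s K_ge_1 M[of "{..<n}"] by (intro mult_left_mono) auto
    finally show ?thesis using N_add[OF closed_intros(2)[OF v S] S, of n n] by simp
  qed
  moreover have "(\<lambda>n. N (v - ?S n) + s * K * M) \<longlonglongrightarrow> 0 + s * K * M"
    by (intro tendsto_intros expansion[OF v])
  ultimately show ?thesis
    by (intro LIMSEQ_le_const[where X="\<lambda>n. N (v - ?S n) + s * K * M"]) auto
qed

text \<open>If the sums \<open>\<Sum>k\<in>F. x k\<close> were bounded, the norm would be a supremum norm in the coordinates
  of \<open>x\<close>. The unit vectors are bounded and tend to \<open>0\<close> in each of these coordinates, so a gliding
  hump chooses arbitrarily many of them whose sum stays bounded; but the sum of \<open>m\<close> unit vectors
  has norm at least of the order \<open>m powr (1 / p)\<close>.\<close>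

lemma indicator_sums_unbounded: "\<exists>F. finite F \<and> M < N (\<Sum>k\<in>F. x k)"
proof (rule ccontr)
  assume "\<not> ?thesis"
  then have M: "\<And>F. finite F \<Longrightarrow> N (\<Sum>k\<in>F. x k) \<le> M" by (meson not_le)
  define T where "T = K / c * D"
  have T: "\<bar>coeff (unit_seq n) k\<bar> \<le> T" for n k
  proof -
    have "\<bar>coeff (unit_seq n) k\<bar> \<le> K / c * N (unit_seq n)" by (rule abs_coeff_le[OF unit_seq_in])
    also have "\<dots> \<le> T" unfolding T_def using K_ge_1 c by (intro mult_left_mono N_unit_seq_le) auto
    finally show ?thesis .
  qed
  have "0 \<le> T" using T[of 0 0] by linarith
  \<comment> \<open>A new unit vector disturbs the coordinates below \<open>k0\<close> by at most \<open>(1 / 2) ^ Suc m\<close>, and meets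
    a sum with entries below \<open>1 / 2\<close> in the others; the geometric series keeps the total bounded.\<close>
  have hump: "\<exists>F. finite F \<and> card F = m \<and>
      (\<forall>k. \<bar>coeff (\<Sum>n\<in>F. unit_seq n) k\<bar> \<le> T + 2 - (1 / 2) ^ m)" for m
  proof (induction m)
    case 0
    show ?case using \<open>0 \<le> T\<close> by (intro exI[of _ "{}"]) (simp add: f_0[unfolded zero_fun_def] f_0)
  next
    case (Suc m)
    then obtain F where F: "finite F" "card F = m"
      "\<And>k. \<bar>coeff (\<Sum>n\<in>F. unit_seq n) k\<bar> \<le> T + 2 - (1 / 2) ^ m" by blast
    define s where "s = (\<Sum>n\<in>F. unit_seq n)"
    have s: "s \<in> X" unfolding s_def using unit_seq_in by (intro closed_intros)
    obtain k0 where k0: "\<And>k. k0 \<le> k \<Longrightarrow> \<bar>coeff s k\<bar> < 1 / 2"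
      using LIMSEQ_D[OF coeff_tendsto_0[OF s], of "1 / 2"] by auto
    have "finite (F \<union> (\<Union>k<k0. {n. (1 / 2) ^ Suc m < \<bar>coeff (unit_seq n) k\<bar>}))"
      using F(1) by (intro finite_UnI finite_UN_I finite_lessThan coeff_unit_seq_finite) auto
    then obtain n where "n \<notin> F \<union> (\<Union>k<k0. {n. (1 / 2) ^ Suc m < \<bar>coeff (unit_seq n) k\<bar>})"
      using ex_new_if_finite[OF infinite_UNIV_nat] by blast
    then have n: "n \<notin> F" "\<And>k. k < k0 \<Longrightarrow> \<bar>coeff (unit_seq n) k\<bar> \<le> (1 / 2) ^ Suc m"
      by (auto simp del: power_Suc simp: not_less)
    have "\<bar>coeff (\<Sum>n\<in>insert n F. unit_seq n) k\<bar> \<le> T + 2 - (1 / 2) ^ Suc m" for k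
    proof -
      have eq: "coeff (\<Sum>n\<in>insert n F. unit_seq n) k = coeff (unit_seq n) k + coeff s k"
        using F(1) n(1) s unit_seq_in by (simp add: s_def coeff_add)
      have half: "(1 / 2 :: real) ^ Suc m \<le> 1" by (intro power_le_one) auto
      show ?thesis
      proof (cases "k < k0")
        case True
        then show ?thesis using n(2)[OF True] F(3)[of k] unfolding eq s_def[symmetric] by simp
      next
        case False
        then show ?thesis using k0[of k] T[of n k] half unfolding eq
          by (simp add: abs_le_iff) linarith
      qed
    qed
    moreover have "finite (insert n F)" "card (insert n F) = Suc m" using F n(1) by auto
    ultimately show ?case by blast
  qed
  define B where "B = \<bar>D * ((T + 2) * K * M)\<bar>"
  have le: "real m powr (1 / p) \<le> B" for m
  proof -
    obtain F where F: "finite F" "card F = m"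
      "\<And>k. \<bar>coeff (\<Sum>n\<in>F. unit_seq n) k\<bar> \<le> T + 2 - (1 / 2) ^ m" using hump by blast
    define s where "s = (\<Sum>n\<in>F. 1 *\<^sub>R unit_seq n)"
    have s: "s \<in> X" unfolding s_def by (rule unit.span_in)
    have "\<bar>coeff s k\<bar> \<le> T + 2" for k
    proof -
      have "0 \<le> (1 / 2 :: real) ^ m" by simp
      moreover have s': "s = (\<Sum>n\<in>F. unit_seq n)" by (simp add: s_def)
      ultimately show ?thesis using F(3)[of k] unfolding s' by linarith
    qed
    then have "N s \<le> (T + 2) * K * M" using \<open>0 \<le> T\<close> by (intro N_le_sup_coeff[OF M s]) auto
    then have "D * N s \<le> D * ((T + 2) * K * M)" using D by (intro mult_left_mono) auto
    moreover have "real (card F) powr (1 / p) * 1 \<le> W s"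
      by (intro card_powr_le_norm[OF p in_weak_lp[OF s] F(1)])
        (unfold s_def sum_unit_seq[OF F(1)], simp)
    ultimately show ?thesis using W_le_N[OF s] F(2) unfolding B_def by simp
  qed
  have "0 \<le> B" by (simp add: B_def)
  obtain m :: nat where m: "(B + 1) powr p < real m" using reals_Archimedean2 by blast
  have "B + 1 = ((B + 1) powr p) powr (1 / p)"
    using \<open>0 \<le> B\<close> p by (simp add: powr_powr)
  also have "\<dots> \<le> real m powr (1 / p)" using m p by (intro powr_mono2) auto
  finally show False using le[of m] by simp
qed

text \<open>By democracy, sums over all sets of some fixed size are large once one such sum is.\<close>

lemma indicator_sums_large: "\<exists>m. \<forall>F. finite F \<and> card F = m \<longrightarrow> M < N (\<Sum>k\<in>F. x k)"
proof -
  obtain C where C: "1 \<le> C" "\<And>A B. finite A \<Longrightarrow> finite B \<Longrightarrow> card A = card B \<Longrightarrow>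
      N (\<Sum>k\<in>A. x k) \<le> C * N (\<Sum>k\<in>B. x k)"
    by (fact democratic)
  obtain A where A: "finite A" "C * M < N (\<Sum>k\<in>A. x k)"
    using indicator_sums_unbounded by blast
  have "M < N (\<Sum>k\<in>F. x k)" if "finite F" "card F = card A" for F
  proof -
    have "C * M < C * N (\<Sum>k\<in>F. x k)" using A C(2)[OF A(1) that(1)] that(2) by simp
    then show ?thesis using C(1) by simp
  qed
  then show ?thesis by blast
qed

lemma W_basis_le: "W (x k) \<le> D * R"
  by (rule order_trans[OF W_le_N[OF basis_in] mult_left_mono[OF R]]) (use D in simp)

text \<open>Split \<open>x k\<close> into its entries of size at least \<open>\<epsilon>\<close> and the rest \<open>y\<close>. The number of large
  entries is bounded in terms of \<open>\<epsilon>\<close> alone. For the index \<open>k\<close> that belongs to a small \<open>\<delta>\<close>, the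
  \<open>k\<close>-th functional is less than \<open>\<delta>\<close> on the unit vectors at these entries, so \<open>y\<close> still carries
  at least half of the coordinate \<open>1\<close> of \<open>x k\<close>. Each fixed \<open>k\<close> stops occurring as \<open>\<epsilon>\<close> decreases,
  since \<open>y\<close> then tends to \<open>0\<close> in norm; this keeps \<open>k\<close> out of \<open>F\<close>.\<close>

lemma small_piece:
  assumes neg: "\<forall>\<delta>>0. \<exists>k. \<forall>n. \<bar>x k n\<bar> < \<delta> \<or> \<bar>coeff (unit_seq n) k\<bar> < \<delta>"
    and \<epsilon>: "0 < \<epsilon>" and F: "finite F"
  obtains k y where "k \<notin> F" "y \<in> X" "\<And>n. \<bar>y n\<bar> \<le> \<bar>x k n\<bar>" "\<And>n. \<bar>y n\<bar> \<le> \<epsilon>" "1 / 2 \<le> \<bar>coeff y k\<bar>"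
proof -
  have "\<exists>e>0. \<forall>y. (\<forall>n. \<bar>y n\<bar> \<le> \<bar>x k n\<bar>) \<and> (\<forall>n. \<bar>y n\<bar> \<le> e) \<longrightarrow> \<bar>coeff y k\<bar> < 1 / 2" for k
  proof -
    define L where "L = K / c * D"
    define \<eta> where "\<eta> = 1 / (4 * L)"
    have pos: "0 < L" unfolding L_def using K_ge_1 c D by simp
    then have \<eta>: "0 < \<eta>" by (simp add: \<eta>_def)
    obtain e where e: "0 < e" "\<And>y. (\<And>n. \<bar>y n\<bar> \<le> \<bar>x k n\<bar>) \<Longrightarrow> (\<And>n. \<bar>y n\<bar> \<le> e) \<Longrightarrow> W y \<le> \<eta>"
      by (fact norm_dominated_small_entries[OF p in_vanishing[OF basis_in] \<eta>])
    have "\<bar>coeff y k\<bar> < 1 / 2" if y: "\<forall>n. \<bar>y n\<bar> \<le> \<bar>x k n\<bar>" "\<forall>n. \<bar>y n\<bar> \<le> e" for y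
    proof -
      have yX: "y \<in> X" using y(1) by (intro solid[OF basis_in]) auto
      have "\<bar>coeff y k\<bar> \<le> K / c * N y" by (rule abs_coeff_le[OF yX])
      also have "\<dots> \<le> K / c * (D * W y)" using K_ge_1 c by (intro mult_left_mono N_le_W[OF yX]) auto
      also have "\<dots> = L * W y" by (simp add: L_def)
      also have "\<dots> \<le> L * \<eta>" using y pos by (intro mult_left_mono e(2)) auto
      also have "\<dots> = 1 / 4" unfolding \<eta>_def using pos by simp
      finally show ?thesis by simp
    qed
    then show ?thesis using e(1) by blast
  qed
  then obtain e where e: "\<And>k. 0 < e k"
    "\<And>k y. (\<forall>n. \<bar>y n\<bar> \<le> \<bar>x k n\<bar>) \<and> (\<forall>n. \<bar>y n\<bar> \<le> e k) \<Longrightarrow> \<bar>coeff y k\<bar> < 1 / 2"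
    by metis
  define \<epsilon>' where "\<epsilon>' = Min (insert \<epsilon> (e ` F))"
  have \<epsilon>': "0 < \<epsilon>'" "\<epsilon>' \<le> \<epsilon>" "\<And>k. k \<in> F \<Longrightarrow> \<epsilon>' \<le> e k"
    using F \<epsilon> e(1) by (auto simp: \<epsilon>'_def)
  define B where "B = D * R"
  have B: "\<bar>x k n\<bar> \<le> B" for k n
    using abs_le_weak_lp_norm[OF p in_weak_lp[OF basis_in], of k n] W_basis_le[of k] by (simp add: B_def)
  have "0 \<le> B" using B[of 0 0] by linarith
  \<comment> \<open>\<open>q\<close> bounds the number of entries of size at least \<open>\<epsilon>'\<close>, so that these contribute at most
    \<open>q * B * \<delta>\<close> to the \<open>k\<close>-th coordinate.\<close>
  define q where "q = (B / \<epsilon>') powr p"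
  define \<delta> where "\<delta> = min \<epsilon>' (1 / (2 * (q * B + 1)))"
  have qB: "0 \<le> q * B" using \<open>0 \<le> B\<close> by (simp add: q_def)
  have \<delta>: "0 < \<delta>" "\<delta> \<le> \<epsilon>'" "q * B * \<delta> \<le> 1 / 2"
  proof -
    show "0 < \<delta>" "\<delta> \<le> \<epsilon>'" using \<epsilon>'(1) qB by (auto simp: \<delta>_def)
    have "q * B * \<delta> \<le> q * B * (1 / (2 * (q * B + 1)))"
      using qB by (intro mult_left_mono) (auto simp: \<delta>_def)
    also have "\<dots> \<le> 1 / 2" using qB by (simp add: field_simps)
    finally show "q * B * \<delta> \<le> 1 / 2" .
  qed
  obtain k where k: "\<And>n. \<bar>x k n\<bar> < \<delta> \<or> \<bar>coeff (unit_seq n) k\<bar> < \<delta>" using neg \<delta>(1) by blast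
  define S where "S = {n. \<epsilon>' \<le> \<bar>x k n\<bar>}"
  have xk: "x k \<in> weak_lp p" by (rule in_weak_lp[OF basis_in])
  have "finite {n. \<epsilon>' / 2 < \<bar>x k n\<bar>}"
    using xk \<epsilon>'(1) by (intro finite_level) (auto simp: weak_lp_def)
  then have S: "finite S" by (rule rev_finite_subset) (use \<epsilon>'(1) in \<open>auto simp: S_def\<close>)
  have "real (card S) powr (1 / p) * \<epsilon>' \<le> W (x k)"
    by (rule card_powr_le_norm[OF p xk S]) (simp add: S_def)
  then have "real (card S) powr (1 / p) \<le> B / \<epsilon>'"
    using W_basis_le[of k] \<epsilon>'(1) by (simp add: B_def le_divide_eq)
  then have "(real (card S) powr (1 / p)) powr p \<le> q"
    unfolding q_def using p by (intro powr_mono2) auto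
  then have card_S: "real (card S) \<le> q" using p by (simp add: powr_powr)
  define z where "z = (\<Sum>n\<in>S. x k n *\<^sub>R unit_seq n)"
  have z: "z \<in> X" unfolding z_def by (rule unit.span_in)
  have z_eq: "z = (\<lambda>n. if n \<in> S then x k n else 0)" unfolding z_def by (rule sum_unit_seq[OF S])
  have "\<bar>coeff z k\<bar> \<le> (\<Sum>n\<in>S. \<bar>x k n\<bar> * \<bar>coeff (unit_seq n) k\<bar>)"
    unfolding z_def coeff_sum_unit_seq by (rule order_trans[OF sum_abs]) (simp add: abs_mult)
  also have "\<dots> \<le> (\<Sum>n\<in>S. B * \<delta>)"
  proof (intro sum_mono mult_mono B)
    fix n assume "n \<in> S"
    then have "\<not> \<bar>x k n\<bar> < \<delta>" using \<delta>(2) by (simp add: S_def)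
    then show "\<bar>coeff (unit_seq n) k\<bar> \<le> \<delta>" using k[of n] by simp
  qed (use \<open>0 \<le> B\<close> in auto)
  also have "\<dots> = real (card S) * (B * \<delta>)" by simp
  also have "\<dots> \<le> q * (B * \<delta>)" using card_S \<open>0 \<le> B\<close> \<delta>(1) by (intro mult_right_mono) auto
  finally have cz: "\<bar>coeff z k\<bar> \<le> 1 / 2" using \<delta>(3) by simp
  define y where "y = x k - z"
  have y: "y \<in> X" unfolding y_def by (intro closed_intros basis_in z)
  have "x k = y + z" by (simp add: y_def)
  moreover have "coeff (x k) k = 1" using coeff_finite_sum[of "{k}" "\<lambda>_. 1"] by simp
  ultimately have "1 = coeff y k + coeff z k" using coeff_add[OF y z, of k] by simp
  then have cy: "1 / 2 \<le> \<bar>coeff y k\<bar>" using cz by linarith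
  have y_le: "\<bar>y n\<bar> \<le> \<bar>x k n\<bar>" "\<bar>y n\<bar> \<le> \<epsilon>'" for n
    using \<epsilon>'(1) by (auto simp: y_def z_eq S_def)
  have "k \<notin> F"
  proof
    assume "k \<in> F"
    then have "\<bar>y n\<bar> \<le> e k" for n using y_le(2)[of n] \<epsilon>'(3)[of k] by linarith
    then have "\<bar>coeff y k\<bar> < 1 / 2" using y_le(1) e(2) by blast
    then show False using cy by linarith
  qed
  then show ?thesis using y y_le(1) order_trans[OF y_le(2) \<epsilon>'(2)] cy by (rule that)
qed

text \<open>Otherwise pieces \<open>y k\<close> of arbitrarily many \<open>x k\<close> have entries so small that their absolute
  sum stays bounded, as in \<open>c\<^sub>0\<close>. By averaging over signs, the sums of these \<open>x k\<close>
  then are bounded too, whatever their number.\<close>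

lemma common_large_coordinate:
  "\<exists>\<delta>>0. \<forall>k. \<exists>n. \<delta> \<le> \<bar>x k n\<bar> \<and> \<delta> \<le> \<bar>coeff (unit_seq n) k\<bar>"
proof (rule ccontr)
  assume "\<not> ?thesis"
  then have neg: "\<forall>\<delta>>0. \<exists>k. \<forall>n. \<bar>x k n\<bar> < \<delta> \<or> \<bar>coeff (unit_seq n) k\<bar> < \<delta>"
    unfolding not_le[symmetric] by blast
  define B where "B = D * R"
  have "0 \<le> B" using W_nonneg[OF basis_in, of 0] W_basis_le[of 0] by (simp add: B_def)
  \<comment> \<open>The excess over \<open>B\<close> grows by \<open>(1 / 2) ^ Suc m\<close> in the step from \<open>m\<close> to \<open>Suc m\<close>.\<close>
  have pieces: "\<exists>F y. finite F \<and> card F = m \<and> (\<forall>k. y k \<in> X) \<and> (\<forall>k\<in>F. 1 / 2 \<le> \<bar>coeff (y k) k\<bar>) \<and>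
      W (\<lambda>n. \<Sum>k\<in>F. \<bar>y k n\<bar>) \<le> B + 1 - (1 / 2) ^ m" for m
  proof (induction m)
    case 0
    have "W 0 \<le> B" using W_mono[OF basis_in, of 0 0] W_basis_le[of 0] by (simp add: B_def)
    then show ?case using closed_intros(4)
      by (intro exI[of _ "{}"] exI[of _ "\<lambda>_. 0"]) (simp add: zero_fun_def)
  next
    case (Suc m)
    then obtain F y where F: "finite F" "card F = m" and y: "\<And>k. y k \<in> X"
        "\<And>k. k \<in> F \<Longrightarrow> 1 / 2 \<le> \<bar>coeff (y k) k\<bar>"
        and W: "W (\<lambda>n. \<Sum>k\<in>F. \<bar>y k n\<bar>) \<le> B + 1 - (1 / 2) ^ m"
      by blast
    define s where "s = (\<Sum>k\<in>F. (\<lambda>n. \<bar>y k n\<bar>))"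
    have s_eq: "s = (\<lambda>n. \<Sum>k\<in>F. \<bar>y k n\<bar>)" unfolding s_def by (rule ext) (rule sum_fun_apply)
    have "(\<lambda>n. \<bar>y k n\<bar>) \<in> X" for k by (rule solid[OF y(1)[of k]]) simp
  then have s: "s \<in> X" unfolding s_def by (intro closed_intros)
    have half: "0 < (1 / 2 :: real) ^ Suc m" "(1 / 2 :: real) ^ m \<le> 1"
      by (auto intro: power_le_one)
    obtain \<epsilon> where \<epsilon>: "0 < \<epsilon>"
      "\<And>w. w \<in> weak_lp p \<Longrightarrow> W w \<le> B \<Longrightarrow> (\<And>n. \<bar>w n\<bar> \<le> \<epsilon>) \<Longrightarrow>
        W (\<lambda>n. \<bar>s n\<bar> + \<bar>w n\<bar>) \<le> max (W s) B + (1 / 2) ^ Suc m"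
      by (fact norm_add_small_entries[OF p in_weak_lp[OF s] in_vanishing[OF s] half(1)])
    obtain j w where w: "j \<notin> F" "w \<in> X" "\<And>n. \<bar>w n\<bar> \<le> \<bar>x j n\<bar>" "\<And>n. \<bar>w n\<bar> \<le> \<epsilon>"
        "1 / 2 \<le> \<bar>coeff w j\<bar>"
      by (fact small_piece[OF neg \<epsilon>(1) F(1)])
    have "W w \<le> B" using W_mono[OF basis_in w(3)] W_basis_le[of j] by (simp add: B_def)
    then have "W (\<lambda>n. \<bar>s n\<bar> + \<bar>w n\<bar>) \<le> max (W s) B + (1 / 2) ^ Suc m"
      by (intro \<epsilon>(2) in_weak_lp w)
    also have "\<dots> \<le> B + 1 - (1 / 2) ^ Suc m" using W half(2) unfolding s_eq by simp
    also have "(\<lambda>n. \<bar>s n\<bar> + \<bar>w n\<bar>) = (\<lambda>n. \<Sum>k\<in>insert j F. \<bar>(y(j := w)) k n\<bar>)"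
    proof
      fix n
      have "(\<Sum>k\<in>F. \<bar>(y(j := w)) k n\<bar>) = (\<Sum>k\<in>F. \<bar>y k n\<bar>)"
        using w(1) by (intro sum.cong) auto
      then show "\<bar>s n\<bar> + \<bar>w n\<bar> = (\<Sum>k\<in>insert j F. \<bar>(y(j := w)) k n\<bar>)"
        using F(1) w(1) by (simp add: s_eq sum_nonneg)
    qed
    finally show ?case
      using F y w(1,2,5) by (intro exI[of _ "insert j F"] exI[of _ "y(j := w)"]) auto
  qed
  obtain m where m: "\<And>F. finite F \<Longrightarrow> card F = m \<Longrightarrow> 2 * K * (K * (D * (B + 1))) < N (\<Sum>k\<in>F. x k)"
    using indicator_sums_large by blast
  obtain F y where F: "finite F" "card F = m" and y: "\<And>k. y k \<in> X"
      "\<And>k. k \<in> F \<Longrightarrow> 1 / 2 \<le> \<bar>coeff (y k) k\<bar>"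
      and W: "W (\<lambda>n. \<Sum>k\<in>F. \<bar>y k n\<bar>) \<le> B + 1 - (1 / 2) ^ m"
    using pieces[of m] by blast
  define s where "s = (\<Sum>k\<in>F. (\<lambda>n. \<bar>y k n\<bar>))"
  have s_eq: "s = (\<lambda>n. \<Sum>k\<in>F. \<bar>y k n\<bar>)" unfolding s_def by (rule ext) (rule sum_fun_apply)
  have "(\<lambda>n. \<bar>y k n\<bar>) \<in> X" for k by (rule solid[OF y(1)[of k]]) simp
  then have s: "s \<in> X" unfolding s_def by (intro closed_intros)
  have Ws: "W s \<le> B + 1"
  proof -
    have "0 \<le> (1 / 2 :: real) ^ m" by simp
    then show ?thesis using W unfolding s_eq by linarith
  qed
  define v where "v = (\<Sum>k\<in>F. coeff (y k) k *\<^sub>R x k)"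
  have v: "v \<in> X" unfolding v_def by (rule partial_sum_in)
  have "N v \<le> K * (D * (B + 1))"
    unfolding v_def
  proof (rule diagonal[OF F(1) inj_on_id2 y(1)])
    fix \<epsilon> :: "nat \<Rightarrow> real" assume \<epsilon>: "\<And>k. \<bar>\<epsilon> k\<bar> = 1"
    let ?u = "\<Sum>k\<in>F. \<epsilon> k *\<^sub>R y k"
    have u: "?u \<in> X" by (intro closed_intros y)
    have "\<bar>?u n\<bar> \<le> \<bar>s n\<bar>" for n
    proof -
      have "\<bar>?u n\<bar> \<le> (\<Sum>k\<in>F. \<bar>\<epsilon> k * y k n\<bar>)"
        unfolding sum_fun_apply scaleR_fun_def real_scaleR_def by (rule sum_abs)
      also have "\<dots> = s n" unfolding s_eq by (simp add: abs_mult \<epsilon>)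
      finally show ?thesis by simp
    qed
    then have "W ?u \<le> B + 1" by (rule order_trans[OF W_mono[OF s] Ws])
    then have "D * W ?u \<le> D * (B + 1)" using D by (intro mult_left_mono) auto
    then show "N ?u \<le> D * (B + 1)" using N_le_W[OF u] by linarith
  qed
  then have "2 * K * N v \<le> 2 * K * (K * (D * (B + 1)))" using K_ge_1 by (intro mult_left_mono) auto
  moreover have "N (\<Sum>k\<in>F. 1 *\<^sub>R x k) \<le> 2 * K * N v"
  proof (rule dominated_coefficients[OF F(1) v])
    fix k assume "k \<in> F"
    then show "\<bar>1\<bar> \<le> 2 * \<bar>coeff v k\<bar>" using y(2)[of k] by (simp add: v_def coeff_finite_sum[OF F(1)])
  qed simp
  ultimately show False using m[OF F] by simp
qed

end

context greedy_basis_of_weak_lp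
begin

text \<open>A coordinate shared by many \<open>k\<close> would give a unit vector the norm of a long sum of basis
  vectors.\<close>

lemma bounded_multiplicity:
  assumes \<delta>: "0 < \<delta>" and h: "\<And>k. \<delta> \<le> \<bar>coeff (unit_seq (h k)) k\<bar>"
  obtains m where "\<And>n. finite {k. h k = n}" "\<And>n. card {k. h k = n} < m"
proof -
  obtain m where m: "\<And>F. finite F \<Longrightarrow> card F = m \<Longrightarrow> 1 / \<delta> * K * D < N (\<Sum>k\<in>F. x k)"
    using indicator_sums_large by blast
  have no: "card F \<noteq> m" if F: "finite F" "F \<subseteq> {k. h k = n}" for F n
  proof
    assume card: "card F = m"
    have "N (\<Sum>k\<in>F. 1 *\<^sub>R x k) \<le> 1 / \<delta> * K * N (unit_seq n)"
    proof (rule dominated_coefficients[OF F(1) unit_seq_in])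
      fix k assume "k \<in> F"
      then have "\<delta> \<le> \<bar>coeff (unit_seq n) k\<bar>" using F(2) h[of k] by auto
      then show "\<bar>1\<bar> \<le> 1 / \<delta> * \<bar>coeff (unit_seq n) k\<bar>" using \<delta> by simp
    qed (use \<delta> in simp)
    also have "\<dots> \<le> 1 / \<delta> * K * D" using \<delta> K_ge_1 by (intro mult_left_mono N_unit_seq_le) auto
    finally show False using m[OF F(1) card] by simp
  qed
  show ?thesis
  proof (rule that[of m])
    fix n
    show fin: "finite {k. h k = n}"
    proof (rule ccontr)
      assume "infinite {k. h k = n}"
      then obtain F where "finite F" "card F = m" "F \<subseteq> {k. h k = n}"
        using infinite_arbitrarily_large by metis
      then show False using no by blast
    qed
    show "card {k. h k = n} < m"
    proof (rule ccontr)
      assume "\<not> card {k. h k = n} < m"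
      then obtain F where "F \<subseteq> {k. h k = n}" "card F = m" "finite F"
        using obtain_subset_with_card_n[of m "{k. h k = n}"] by (auto simp: not_less)
      then show False using no by blast
    qed
  qed
qed

lemma unit_sum_permuted:
  assumes G: "finite G" "inj_on h G"
  shows "(\<Sum>k\<in>G. a k *\<^sub>R unit_seq (h k)) = (\<lambda>n. if n \<in> h ` G then a (the_inv_into G h n) else 0)"
proof -
  have "(\<Sum>k\<in>G. a k *\<^sub>R unit_seq (h k)) = (\<Sum>n\<in>h ` G. a (the_inv_into G h n) *\<^sub>R unit_seq n)"
    using G(2) by (simp add: sum.reindex the_inv_into_f_f)
  then show ?thesis using G(1) by (simp add: sum_unit_seq)
qed

text \<open>The matrix that expresses \<open>unit_seq (h k)\<close> through \<open>x\<close> has diagonal entries of size at least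
  \<open>\<delta>\<close>, and relabelling \<open>h k\<close> as \<open>k\<close> does not change the norm \<open>W\<close>.\<close>

lemma upper_estimate_on_class:
  assumes \<delta>: "0 < \<delta>" and h: "\<And>k. \<delta> \<le> \<bar>coeff (unit_seq (h k)) k\<bar>"
    and G: "finite G" "inj_on h G"
  shows "N (\<Sum>k\<in>G. a k *\<^sub>R x k) \<le> 1 / \<delta> * K * (K * (D * W (\<Sum>k\<in>G. a k *\<^sub>R unit_seq k)))"
proof -
  let ?s = "\<Sum>k\<in>G. a k *\<^sub>R unit_seq k"
  define y where "y k = a k *\<^sub>R unit_seq (h k)" for k
  have y: "y k \<in> X" for k unfolding y_def by (intro closed_intros unit_seq_in)
  have fy: "coeff (y k) k = a k * coeff (unit_seq (h k)) k" for k
    unfolding y_def by (rule coeff_scale[OF unit_seq_in])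
  define v where "v = (\<Sum>k\<in>G. coeff (y k) k *\<^sub>R x k)"
  have "N v \<le> K * (D * W ?s)"
    unfolding v_def
  proof (rule diagonal[OF G(1) inj_on_id2 y])
    fix \<epsilon> :: "nat \<Rightarrow> real" assume \<epsilon>: "\<And>k. \<bar>\<epsilon> k\<bar> = 1"
    let ?u = "\<Sum>k\<in>G. \<epsilon> k *\<^sub>R y k" and ?g = "the_inv_into G h"
    have u: "?u \<in> X" by (intro closed_intros y)
    have "?u = (\<Sum>k\<in>G. (\<epsilon> k * a k) *\<^sub>R unit_seq (h k))" by (simp add: y_def)
    then have u_eq: "?u = (\<lambda>n. if n \<in> h ` G then \<epsilon> (?g n) * a (?g n) else 0)"
      unfolding unit_sum_permuted[OF G] .
    have "W ?u \<le> W ?s"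
    proof (rule weak_lp_norm_rearrangement[OF p in_weak_lp[OF unit.span_in]])
      have "inj_on ?g (h ` G)" by (rule inj_on_the_inv_into[OF G(2)])
      then show "inj_on ?g {n. ?u n \<noteq> 0}"
        by (rule inj_on_subset) (auto simp: u_eq)
      show "\<bar>?u n\<bar> \<le> \<bar>?s (?g n)\<bar>" for n
        using the_inv_into_into[OF G(2), of n G] by (auto simp: u_eq sum_unit_seq[OF G(1)] abs_mult \<epsilon>)
    qed
    then have "D * W ?u \<le> D * W ?s" using D by (intro mult_left_mono) auto
    then show "N ?u \<le> D * W ?s" using N_le_W[OF u] by linarith
  qed
  moreover have "N (\<Sum>k\<in>G. a k *\<^sub>R x k) \<le> 1 / \<delta> * K * N v"
  proof (rule dominated_coefficients[OF G(1)])
    show "v \<in> X" unfolding v_def by (rule partial_sum_in)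
    fix k assume "k \<in> G"
    then have "coeff v k = a k * coeff (unit_seq (h k)) k"
      by (simp add: v_def coeff_finite_sum[OF G(1)] fy)
    moreover have "\<bar>a k\<bar> * \<delta> \<le> \<bar>a k\<bar> * \<bar>coeff (unit_seq (h k)) k\<bar>"
      by (intro mult_left_mono h) auto
    ultimately show "\<bar>a k\<bar> \<le> 1 / \<delta> * \<bar>coeff v k\<bar>" using \<delta> by (simp add: abs_mult le_divide_eq)
  qed (use \<delta> in simp)
  moreover have "0 \<le> 1 / \<delta> * K" using \<delta> K_ge_1 by simp
  ultimately show ?thesis using mult_left_mono order_trans by blast
qed

text \<open>Here the diagonal is that of the matrix expressing \<open>x k\<close> through the unit vectors. Passing from
  \<open>F\<close> to \<open>G\<close> and changing signs are multipliers on the \<open>x\<close>-coordinates.\<close>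

lemma lower_estimate_on_class:
  assumes \<delta>: "0 < \<delta>" and h: "\<And>k. \<delta> \<le> \<bar>x k (h k)\<bar>"
    and F: "finite F" and G: "G \<subseteq> F" "inj_on h G"
  shows "W (\<Sum>k\<in>G. a k *\<^sub>R unit_seq k) \<le> 1 / \<delta> * (D * (D * D * (K * N (\<Sum>k\<in>F. a k *\<^sub>R x k))))"
proof -
  have finG: "finite G" using F G(1) finite_subset by blast
  let ?s = "\<Sum>k\<in>G. a k *\<^sub>R unit_seq k"
  define v where "v = (\<Sum>k\<in>F. a k *\<^sub>R x k)"
  have v: "v \<in> X" unfolding v_def by (rule partial_sum_in)
  define u where "u = (\<Sum>k\<in>G. (a k *\<^sub>R x k) (h k) *\<^sub>R unit_seq (h k))"
  have u: "u \<in> X" unfolding u_def by (rule unit.span_in)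
  have "N u \<le> D * D * (K * N v)"
    unfolding u_def
  proof (rule unit.diagonal[OF finG G(2)])
    show "a k *\<^sub>R x k \<in> X" for k by (intro closed_intros basis_in)
    fix \<epsilon> :: "nat \<Rightarrow> real" assume \<epsilon>: "\<And>k. \<bar>\<epsilon> k\<bar> = 1"
    have eq: "(\<Sum>k\<in>G. \<epsilon> k *\<^sub>R (a k *\<^sub>R x k)) = (\<Sum>k\<in>G. (\<epsilon> k * coeff v k) *\<^sub>R x k)"
      using G(1) by (intro sum.cong) (auto simp: v_def coeff_finite_sum[OF F])
    show "N (\<Sum>k\<in>G. \<epsilon> k *\<^sub>R (a k *\<^sub>R x k)) \<le> K * N v"
      unfolding eq using \<epsilon> by (intro multiplier finG v) simp
  qed
  then have "D * N u \<le> D * (D * D * (K * N v))" using D by (intro mult_left_mono) auto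
  then have Wu: "W u \<le> D * (D * D * (K * N v))" using W_le_N[OF u] by linarith
  have u_eq: "u (h k) = a k * x k (h k)" if "k \<in> G" for k
    unfolding u_def unit_sum_permuted[OF finG G(2)]
    using that by (simp add: the_inv_into_f_f[OF G(2)] scaleR_fun_def)
  have "W (\<delta> *\<^sub>R ?s) \<le> W u"
  proof (rule weak_lp_norm_rearrangement[OF p in_weak_lp[OF u]])
    have s_eq: "(\<delta> *\<^sub>R ?s) n = (if n \<in> G then \<delta> * a n else 0)" for n
      unfolding sum_unit_seq[OF finG] by (simp add: scaleR_fun_def)
    show "inj_on h {n. (\<delta> *\<^sub>R ?s) n \<noteq> 0}"
      by (rule inj_on_subset[OF G(2)]) (auto simp: s_eq)
    fix n
    show "\<bar>(\<delta> *\<^sub>R ?s) n\<bar> \<le> \<bar>u (h n)\<bar>"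
    proof (cases "n \<in> G")
      case True
      have "\<delta> * \<bar>a n\<bar> \<le> \<bar>x n (h n)\<bar> * \<bar>a n\<bar>" by (intro mult_right_mono h) auto
      then show ?thesis using True \<delta> by (simp add: s_eq u_eq abs_mult mult.commute)
    qed (simp add: s_eq)
  qed
  then have "1 / \<delta> * W (\<delta> *\<^sub>R ?s) \<le> 1 / \<delta> * (D * (D * D * (K * N v)))"
    using Wu \<delta> by (intro mult_left_mono) auto
  moreover have "W ?s \<le> 1 / \<delta> * W (\<delta> *\<^sub>R ?s)"
  proof -
    have "\<delta> *\<^sub>R ?s \<in> weak_lp p" by (intro in_weak_lp closed_intros unit_seq_in)
    from weak_lp_scale(2)[OF p this, of "1 / \<delta>"] show ?thesis using \<delta> by simp
  qed
  ultimately show ?thesis unfolding v_def by linarith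
qed

text \<open>Counting the earlier indices with the same coordinate splits the indices into finitely many
  classes, on each of which \<open>k \<mapsto> h k\<close> is injective.\<close>

lemma equivalent_to_unit_seq: "equivalent_bases N x unit_seq"
proof -
  obtain \<delta> where \<delta>: "0 < \<delta>"
    and "\<forall>k. \<exists>n. \<delta> \<le> \<bar>x k n\<bar> \<and> \<delta> \<le> \<bar>coeff (unit_seq n) k\<bar>"
    using common_large_coordinate by blast
  then obtain h where h: "\<And>k. \<delta> \<le> \<bar>x k (h k)\<bar>" "\<And>k. \<delta> \<le> \<bar>coeff (unit_seq (h k)) k\<bar>" by metis
  obtain m where m: "\<And>n. finite {k. h k = n}" "\<And>n. card {k. h k = n} < m"
    using bounded_multiplicity[OF \<delta> h(2)] by blast
  define r where "r k = card {j. j < k \<and> h j = h k}" for k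
  have r_less: "r k < m" for k
  proof -
    have "r k \<le> card {j. h j = h k}" unfolding r_def using m(1) by (intro card_mono) auto
    then show ?thesis using m(2)[of "h k"] by linarith
  qed
  have "r j < r k" if "j < k" "h j = h k" for j k
    unfolding r_def using that by (intro psubset_card_mono) auto
  then have inj: "inj_on h {k \<in> F. r k = i}" for F i
    by (intro inj_onI) (metis (mono_tags, lifting) less_irrefl mem_Collect_eq nat_neq_iff)
  define U where "U = 1 / \<delta> * K * (K * D)"
  define L where "L = 1 / \<delta> * (D * (D * D * K))"
  have UL: "0 \<le> U" "0 \<le> L" using \<delta> K_ge_1 D by (auto simp: U_def L_def)
  define C where "C = 1 + real m * U * D + D * (real m * L)"
  have C: "1 \<le> C" "real m * U * D \<le> C" "D * (real m * L) \<le> C"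
    using UL D by (auto simp: C_def)
  have "inverse C * N (\<Sum>k\<in>F. a k *\<^sub>R x k) \<le> N (\<Sum>k\<in>F. a k *\<^sub>R unit_seq k) \<and>
      N (\<Sum>k\<in>F. a k *\<^sub>R unit_seq k) \<le> C * N (\<Sum>k\<in>F. a k *\<^sub>R x k)" if F: "finite F" for F a
  proof -
    define G where "G i = {k \<in> F. r k = i}" for i
    have G: "finite (G i)" "G i \<subseteq> F" "inj_on h (G i)" for i using F inj by (auto simp: G_def)
    have classes: "(\<Sum>i<m. \<Sum>k\<in>G i. w k) = (\<Sum>k\<in>F. w k)" for w :: "nat \<Rightarrow> nat \<Rightarrow> real"
      unfolding G_def using F r_less by (intro sum.group) auto
    let ?sx = "\<lambda>F. \<Sum>k\<in>F. a k *\<^sub>R x k" and ?se = "\<lambda>F. \<Sum>k\<in>F. a k *\<^sub>R unit_seq k"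
    have X: "?sx A \<in> X" "?se A \<in> X" for A by (rule partial_sum_in unit.span_in)+
    have "N (?sx (G i)) \<le> U * (D * N (?se F))" for i
    proof -
      have "N (?sx (G i)) \<le> U * W (?se (G i))"
        using upper_estimate_on_class[OF \<delta> h(2) G(1,3), of a i] by (simp add: U_def mult_ac)
      also have "W (?se (G i)) \<le> W (?se F)"
        using G(2)[of i] by (intro W_mono X) (auto simp: sum_unit_seq[OF F] sum_unit_seq[OF G(1)])
      also have "W (?se F) \<le> D * N (?se F)" by (rule W_le_N[OF X(2)])
      finally show ?thesis using UL by (simp add: mult_left_mono)
    qed
    then have "(\<Sum>i<m. N (?sx (G i))) \<le> real m * (U * (D * N (?se F)))"
      using sum_bounded_above[of "{..<m}" "\<lambda>i. N (?sx (G i))"] by simp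
    then have "N (?sx F) \<le> real m * U * D * N (?se F)"
      using N_sum[of "{..<m}" "\<lambda>i. ?sx (G i)", OF X(1)] unfolding classes by (simp add: mult_ac)
    also have "\<dots> \<le> C * N (?se F)" using C N_nonneg[OF X(2)] by (intro mult_right_mono) auto
    finally have "inverse C * N (?sx F) \<le> N (?se F)" using C(1) by (simp add: field_simps)
    moreover have "N (?se (G i)) \<le> D * (L * N (?sx F))" for i
    proof -
      have "W (?se (G i)) \<le> L * N (?sx F)"
        using lower_estimate_on_class[OF \<delta> h(1) F G(2,3), of a i] by (simp add: L_def mult_ac)
      then have "D * W (?se (G i)) \<le> D * (L * N (?sx F))" using D by (intro mult_left_mono) auto
      then show ?thesis using N_le_W[OF X(2), of "G i"] by linarith
    qed
    then have "(\<Sum>i<m. N (?se (G i))) \<le> real m * (D * (L * N (?sx F)))"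
      using sum_bounded_above[of "{..<m}" "\<lambda>i. N (?se (G i))"] by simp
    then have "N (?se F) \<le> D * (real m * L) * N (?sx F)"
      using N_sum[of "{..<m}" "\<lambda>i. ?se (G i)", OF X(2)] unfolding classes by (simp add: mult_ac)
    then have "N (?se F) \<le> C * N (?sx F)"
      using mult_right_mono[OF C(3) N_nonneg[OF X(1), of F]] by linarith
    ultimately show ?thesis by blast
  qed
  then show ?thesis unfolding equivalent_bases_def Let_def using C(1) by blast
qed

end

section \<open>Uniqueness\<close>

lemma renormed_weak_lp_exists:
  assumes p: "1 < p" and N: "weak_lp_equivalent_norm p N"
  obtains D where "renormed_weak_lp p N D"
proof -
  obtain C where C: "1 \<le> C" "\<And>a. a \<in> weak_lp p \<Longrightarrow>
      inverse C * weak_lp_qnorm p a \<le> N a \<and> N a \<le> C * weak_lp_qnorm p a"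
    and norm: "norm_on (weak_lp p) N"
    using N unfolding weak_lp_equivalent_norm_def banach_space_on_def by blast
  define t where "t = 1 - 1 / p"
  have t: "0 < t" "t \<le> 1" using p by (auto simp: t_def)
  have CD: "C \<le> C / t" using t C(1) by (simp add: le_divide_eq)
  show ?thesis
  proof (rule that[of "C / t"], unfold_locales)
    fix a assume a: "a \<in> weak_lp p"
    have "N a \<le> C * weak_lp_qnorm p a" using C(2)[OF a] by simp
    also have "\<dots> \<le> C * weak_lp_norm p a"
      using C(1) weak_lp_qnorm_equiv(1)[OF p a] by (intro mult_left_mono) auto
    also have "\<dots> \<le> C / t * weak_lp_norm p a"
      using CD weak_lp_norm_nonneg[OF p a] by (rule mult_right_mono)
    finally show "N a \<le> C / t * weak_lp_norm p a" .
    have "inverse C * weak_lp_qnorm p a \<le> N a" using C(2)[OF a] by simp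
    then have "weak_lp_qnorm p a \<le> C * N a" using C(1) by (simp add: field_simps)
    then have "weak_lp_qnorm p a / t \<le> C * N a / t" using t by (intro divide_right_mono) auto
    then show "weak_lp_norm p a \<le> C / t * N a"
      using weak_lp_qnorm_equiv(2)[OF p a] by (simp add: t_def)
  qed (use p norm C(1) CD in auto)
qed

theorem corollary6p7:
  fixes p :: real and N :: "(nat \<Rightarrow> real) \<Rightarrow> real"
  assumes "1 < p"
    and "weak_lp_equivalent_norm p N"
  shows "has_unique_greedy_basis (weak_lp_separable_part p) N"
proof -
  obtain D where "renormed_weak_lp p N D" using renormed_weak_lp_exists[OF assms] .
  then interpret renormed_weak_lp p N D .
  have "equivalent_bases N x unit_seq" if x: "greedy_basis X N x" for x
  proof -
    interpret normed_greedy_basis X N x using x by unfold_locales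
    obtain K where K: "unconditional_system X N x (basis_coeff N x) K" by (fact unconditional)
    obtain c R where cR: "0 < c" "\<And>k. c \<le> N (x k)" "\<And>k. N (x k) \<le> R"
      by (fact semi_normalized_bounds)
    interpret greedy_basis_of_weak_lp p N D x K c R
      using renormed_weak_lp_axioms normed_greedy_basis_axioms K cR
      by (simp add: greedy_basis_of_weak_lp_def greedy_basis_of_weak_lp_axioms_def)
    show ?thesis by (rule equivalent_to_unit_seq)
  qed
  then show ?thesis unfolding has_unique_greedy_basis_def using greedy_basis_unit_seq by blast
qed

end
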